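(* Let $R$ be a field (or a semi-simple ring) and let $(C,f,m)$ be a Floer triple over $R$ with $f(C)\subset\mathbb{Z}$. Choose the sections $\rho$ and $j$ to be $R$-linear, so that $\Psi$ and $\Phi$ are $R$-linear, and put $\partial:=\Phi\circ\delta: F\mathscr{C}\to F\mathscr{C}$, where $F\mathscr{C}$ is the module of bounded-above formal sums $\sum_{b\le b_0}\eta^b$ with $\eta^b\in FH^b_b$; then $\partial^2=0$. The map $\Psi$ induces a filtration preserving isomorphism between the homology $\ker\partial/\operatorname{im}\partial$ of $(F\mathscr{C},\partial)$ and $FH$.
   Context: Floer triple over a ring $R$ with unit: a set $C$, a function $f:C\to\mathbb{Z}$ and a function $m:C\times C\to R$ such that (i) $f^{-1}(a)$ is finite for every $a\in\mathbb{Z}$; (ii) $m(c_1,c_2)\ne0$ implies $f(c_1)\le f(c_2)$; (iii) $\sum_{c_2\in C}m(c_1,c_2)m(c_2,c_3)=0$ for all $c_1,c_3\in C$ (a finite sum by (i),(ii)). Complexes. For integers $a\le b$ let $FC^b_a$ be the free $R$-module on $\{c\in C: a\le f(c)\le b\}$. Let $FC^b=\varprojlim_{a\to-\infty}FC^b_a$, i.e. formal sums $\sum_{a\le b}s_a$ with $s_a\in FC^a_a$, and $FC=\varinjlim_bFC^b=\bigcup_bFC^b$. The differential is the (infinite) linear extension of $dx=\sum_{y\in C}m(y,x)\,y$, inducing $d$ on $FC$, $FC^b$ and $FC^b_a\cong FC^b/FC^{a-1}$. The homologies are $FH$, $FH^b$, $FH^b_a$, with classes written $[s]$, $[s]^b$,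 $[s]^b_a$. If $s^b\in FC^b$ for all $b\le b_0$, the infinite sum $\sum_{b\le b_0}s^b\in FC$ is defined coefficientwise (each coefficient is a finite sum). Exact sequences. For each $b$ the short exact sequence $0\to FC^{b-1}\to FC^b\to FC^b_b\to0$ gives an exact sequence $FH^b_b\xrightarrow{\delta}FH^{b-1}\xrightarrow{\iota}FH^b\xrightarrow{\pi}FH^b_b\xrightarrow{\delta}FH^{b-1}$, where $\delta[n]^b_b=[dn]^{b-1}$. Maps. Let $\aleph^b=\ker\delta=\operatorname{im}\pi\subset FH^b_b$ and $K^b=\delta(FH^{b+1}_{b+1})\subset FH^b$. Let $\aleph$, $K$, $F\mathscr{C}$ be the modules of bounded-above formal sums $\sum_{b\le b_0}\eta^b$ ($b_0\in\mathbb{Z}$) with $\eta^b\in\aleph^b$, resp. $\eta^b\in K^b$, resp. $\eta^b\in FH^b_b$; $\aleph\subset F\mathscr{C}$, and $\delta$ induces $\delta:F\mathscr{C}\to K$ componentwise. Choose for every $b$ maps $\rho:\aleph^b\to FH^b$ with $\pi\circ\rho=\mathrm{id}$, $\rho(0)=0$, and $j:\operatorname{im}(\iota:FH^{b-1}\to FH^b)\to FH^{b-1}$ with $\iota\circ j=\mathrm{id}$, $j(0)=0$. Define - $\Psi:\aleph\to FH$, $\Psi(\sum_{b\le b_0}\eta^b)=[\sum_{b\le b_0}s^b]$, where $s^b\in FC^b$ is a cycle with $[s^b]^b=\rho(\eta^b)$ (well defined); - $\Phi:K\to\aleph$: for $\sum_{b\le b_0}\kappa^b\in K$ set $\sigma^{b_0}=\kappa^{b_0}$,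 $\eta^b=\pi(\sigma^b)$, $\sigma^{b-1}=j(\sigma^b-\rho(\eta^b))+\kappa^{b-1}$ recursively, and $\Phi(\sum\kappa^b)=\sum_{b\le b_0}\eta^b$. If $R$ is a field or semi-simple, $\rho$ and $j$ can be chosen $R$-linear. The filtrations are by the highest index $b$ occurring in a representing sum (on $FH$: by the images of $FH^b\to FH$). *)

theory Defs
  imports Main
begin

text \<open>
  Conventions.  The ring \<open>R\<close> is a type of class \<open>ring_1\<close>, not assumed commutative.  In
  \<open>d x = \<Sum>y. m(y,x) y\<close> the relation \<open>\<Sum>c. m(z,c) m(c,x) = 0\<close> has to give \<open>d \<circ> d = 0\<close>, and \<open>d\<close>
  has to be linear; for non-commutative \<open>R\<close> this forces coefficients to be scaled on the right.
  So all modules below are right modules (over a field there is no difference).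

  A formal sum \<open>\<Sum>a\<le>b. s\<^sub>a\<close> with \<open>s\<^sub>a\<close> in the free module on the finite set \<open>f\<inverse>(a)\<close> is the same as a
  coefficient function \<open>'c \<Rightarrow> 'r\<close> that vanishes off \<open>{c \<in> C. f c \<le> b}\<close>.  Homology classes are cosets,
  that is, sets of such functions.
\<close>

section \<open>Right modules given by carriers, quotients, homology\<close>

record ('r, 'x) rmod =
  rcarrier :: "'x set"
  radd :: "'x \<Rightarrow> 'x \<Rightarrow> 'x"
  rzero :: "'x"
  rscale :: "'x \<Rightarrow> 'r \<Rightarrow> 'x"

definition rminus :: "('r::ring_1, 'x) rmod \<Rightarrow> 'x \<Rightarrow> 'x \<Rightarrow> 'x" where
  "rminus M x y = radd M x (rscale M y (- 1))"

definition rmod_hom :: "('r, 'x) rmod \<Rightarrow> ('r, 'y) rmod \<Rightarrow> ('x \<Rightarrow> 'y) set" where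
  "rmod_hom M N = {h. (\<forall>x\<in>rcarrier M. h x \<in> rcarrier N) \<and>
     (\<forall>x\<in>rcarrier M. \<forall>y\<in>rcarrier M. h (radd M x y) = radd N (h x) (h y)) \<and>
     (\<forall>x\<in>rcarrier M. \<forall>r. h (rscale M x r) = rscale N (h x) r)}"

definition rmod_iso :: "('r, 'x) rmod \<Rightarrow> ('r, 'y) rmod \<Rightarrow> ('x \<Rightarrow> 'y) set" where
  "rmod_iso M N = {h \<in> rmod_hom M N. bij_betw h (rcarrier M) (rcarrier N)}"

definition rcoset :: "('r, 'x) rmod \<Rightarrow> 'x set \<Rightarrow> 'x \<Rightarrow> 'x set" where
  "rcoset M N x = radd M x ` N"

text \<open>Operations on cosets are given by representatives: all members of the unions coincide
  when \<open>N\<close> is a submodule.\<close>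

definition rquot :: "('r, 'x) rmod \<Rightarrow> 'x set \<Rightarrow> ('r, 'x set) rmod" where
  "rquot M N = \<lparr>rcarrier = rcoset M N ` rcarrier M,
     radd = (\<lambda>X Y. \<Union>x\<in>X. \<Union>y\<in>Y. rcoset M N (radd M x y)),
     rzero = N,
     rscale = (\<lambda>X r. \<Union>x\<in>X. rcoset M N (rscale M x r))\<rparr>"

definition cycles :: "('r, 'x) rmod \<Rightarrow> ('x \<Rightarrow> 'x) \<Rightarrow> 'x set" where
  "cycles M d = {x \<in> rcarrier M. d x = rzero M}"

definition homology :: "('r, 'x) rmod \<Rightarrow> ('x \<Rightarrow> 'x) \<Rightarrow> ('r, 'x set) rmod" where
  "homology M d = rquot (M\<lparr>rcarrier := cycles M d\<rparr>) (d ` rcarrier M)"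

definition hclass :: "('r, 'x) rmod \<Rightarrow> ('x \<Rightarrow> 'x) \<Rightarrow> 'x \<Rightarrow> 'x set" where
  "hclass M d x = rcoset M (d ` rcarrier M) x"

definition fun_mod :: "('c \<Rightarrow> 'r::ring_1) set \<Rightarrow> ('r, 'c \<Rightarrow> 'r) rmod" where
  "fun_mod S = \<lparr>rcarrier = S, radd = (\<lambda>s t c. s c + t c), rzero = (\<lambda>c. 0),
     rscale = (\<lambda>s r c. s c * r)\<rparr>"

text \<open>Bounded-above formal sums \<open>\<Sum>b\<le>b0. \<eta>\<^sup>b\<close> with \<open>\<eta>\<^sup>b \<in> M\<^sup>b\<close>.\<close>

definition bounded_sums :: "(int \<Rightarrow> ('r, 'x) rmod) \<Rightarrow> ('r, int \<Rightarrow> 'x) rmod" where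
  "bounded_sums M =
    \<lparr>rcarrier = {\<eta>. (\<forall>b. \<eta> b \<in> rcarrier (M b)) \<and> (\<exists>b0. \<forall>b>b0. \<eta> b = rzero (M b))},
     radd = (\<lambda>\<eta> \<theta> b. radd (M b) (\<eta> b) (\<theta> b)),
     rzero = (\<lambda>b. rzero (M b)),
     rscale = (\<lambda>\<eta> r b. rscale (M b) (\<eta> b) r)\<rparr>"


section \<open>Semisimple rings\<close>

definition right_ideal :: "'r::ring_1 set \<Rightarrow> bool" where
  "right_ideal I \<longleftrightarrow> 0 \<in> I \<and> (\<forall>x\<in>I. \<forall>y\<in>I. x + y \<in> I) \<and> (\<forall>x\<in>I. \<forall>r. x * r \<in> I)"

text \<open>The ring is semisimple as a right module over itself: every submodule is a direct summand.
  (The notion is left-right symmetric.)\<close>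

definition semisimple_ring :: "'r::ring_1 itself \<Rightarrow> bool" where
  "semisimple_ring (_ :: 'r itself) \<longleftrightarrow>
     (\<forall>I :: 'r set. right_ideal I \<longrightarrow>
        (\<exists>J. right_ideal J \<and> I \<inter> J = {0} \<and> (\<forall>x. \<exists>i\<in>I. \<exists>j\<in>J. x = i + j)))"

lemma semisimple_ring_field: "semisimple_ring TYPE('r::field)"
  unfolding semisimple_ring_def
proof (intro allI impI)
  fix I :: "'r set"
  assume I: "right_ideal I"
  show "\<exists>J. right_ideal J \<and> I \<inter> J = {0} \<and> (\<forall>x. \<exists>i\<in>I. \<exists>j\<in>J. x = i + j)"
  proof (cases "I = {0}")
    case True
    then show ?thesis
      by (intro exI[of _ UNIV]) (auto simp: right_ideal_def)
  next
    case False
    then obtain u where u: "u \<in> I" "u \<noteq> 0"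
      using I by (auto simp: right_ideal_def)
    have "x \<in> I" for x
    proof -
      have "u * (inverse u * x) \<in> I" using I u by (auto simp: right_ideal_def)
      then show ?thesis using u by (simp add: field_simps)
    qed
    then show ?thesis
      by (intro exI[of _ "{0}"]) (auto simp: right_ideal_def)
  qed
qed


section \<open>Floer triples and their complexes\<close>

record ('c, 'r) floer_data =
  gens :: "'c set"
  level :: "'c \<Rightarrow> int"
  coef :: "'c \<Rightarrow> 'c \<Rightarrow> 'r"

definition floer_triple :: "('c, 'r::ring_1) floer_data \<Rightarrow> bool" where
  "floer_triple T \<longleftrightarrow>
     (\<forall>a. finite {c \<in> gens T. level T c = a}) \<and>
     (\<forall>c1\<in>gens T. \<forall>c2\<in>gens T. coef T c1 c2 \<noteq> 0 \<longrightarrow> level T c1 \<le> level T c2) \<and>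
     (\<forall>c1\<in>gens T. \<forall>c3\<in>gens T.
        (\<Sum>c2 | c2 \<in> gens T \<and> coef T c1 c2 * coef T c2 c3 \<noteq> 0. coef T c1 c2 * coef T c2 c3) = 0)"

definition FCle :: "('c, 'r::ring_1) floer_data \<Rightarrow> int \<Rightarrow> ('r, 'c \<Rightarrow> 'r) rmod" where
  "FCle T b = fun_mod {s. \<forall>c. s c \<noteq> 0 \<longrightarrow> c \<in> gens T \<and> level T c \<le> b}"

definition FCwin :: "('c, 'r::ring_1) floer_data \<Rightarrow> int \<Rightarrow> int \<Rightarrow> ('r, 'c \<Rightarrow> 'r) rmod" where
  "FCwin T a b = fun_mod {s. \<forall>c. s c \<noteq> 0 \<longrightarrow> c \<in> gens T \<and> a \<le> level T c \<and> level T c \<le> b}"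

definition FC :: "('c, 'r::ring_1) floer_data \<Rightarrow> ('r, 'c \<Rightarrow> 'r) rmod" where
  "FC T = fun_mod (\<Union>b. rcarrier (FCle T b))"

text \<open>For \<open>s\<close> bounded above, only finitely many terms of the sum are non-zero.\<close>

definition diff :: "('c, 'r::ring_1) floer_data \<Rightarrow> ('c \<Rightarrow> 'r) \<Rightarrow> 'c \<Rightarrow> 'r" where
  "diff T s = (\<lambda>y. if y \<in> gens T
     then (\<Sum>x | x \<in> gens T \<and> coef T y x * s x \<noteq> 0. coef T y x * s x) else 0)"

text \<open>The projection \<open>FC\<^sup>b \<rightarrow> FC\<^sup>b / FC\<^sup>a\<^sup>-\<^sup>1\<close> when the quotient is identified with the window module.\<close>

definition trunc :: "('c, 'r::ring_1) floer_data \<Rightarrow> int \<Rightarrow> ('c \<Rightarrow> 'r) \<Rightarrow> 'c \<Rightarrow> 'r" where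
  "trunc T a s = (\<lambda>c. if a \<le> level T c then s c else 0)"

definition diff_win :: "('c, 'r::ring_1) floer_data \<Rightarrow> int \<Rightarrow> ('c \<Rightarrow> 'r) \<Rightarrow> 'c \<Rightarrow> 'r" where
  "diff_win T a s = trunc T a (diff T s)"

definition FH :: "('c, 'r::ring_1) floer_data \<Rightarrow> ('r, ('c \<Rightarrow> 'r) set) rmod" where
  "FH T = homology (FC T) (diff T)"

definition FHle :: "('c, 'r::ring_1) floer_data \<Rightarrow> int \<Rightarrow> ('r, ('c \<Rightarrow> 'r) set) rmod" where
  "FHle T b = homology (FCle T b) (diff T)"

definition FHwin :: "('c, 'r::ring_1) floer_data \<Rightarrow> int \<Rightarrow> int \<Rightarrow> ('r, ('c \<Rightarrow> 'r) set) rmod" where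
  "FHwin T a b = homology (FCwin T a b) (diff_win T a)"

definition cls :: "('c, 'r::ring_1) floer_data \<Rightarrow> ('c \<Rightarrow> 'r) \<Rightarrow> ('c \<Rightarrow> 'r) set" where
  "cls T s = hclass (FC T) (diff T) s"

definition cls_le :: "('c, 'r::ring_1) floer_data \<Rightarrow> int \<Rightarrow> ('c \<Rightarrow> 'r) \<Rightarrow> ('c \<Rightarrow> 'r) set" where
  "cls_le T b s = hclass (FCle T b) (diff T) s"

definition cls_win :: "('c, 'r::ring_1) floer_data \<Rightarrow> int \<Rightarrow> int \<Rightarrow> ('c \<Rightarrow> 'r) \<Rightarrow> ('c \<Rightarrow> 'r) set" where
  "cls_win T a b s = hclass (FCwin T a b) (diff_win T a) s"

text \<open>\<open>\<Sum>b\<le>b0. s\<^sup>b\<close> for \<open>s\<^sup>b \<in> FC\<^sup>b\<close>: the coefficient of \<open>c\<close> in \<open>s\<^sup>b\<close> vanishes for \<open>b < level T c\<close>.\<close>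

definition series :: "('c, 'r::ring_1) floer_data \<Rightarrow> int \<Rightarrow> (int \<Rightarrow> 'c \<Rightarrow> 'r) \<Rightarrow> 'c \<Rightarrow> 'r" where
  "series T b0 s = (\<lambda>c. \<Sum>b\<in>{level T c..b0}. s b c)"


section \<open>The exact sequences and the maps built from them\<close>

text \<open>Maps on homology, given by representatives; all members of each union coincide.\<close>

definition iota :: "('c, 'r::ring_1) floer_data \<Rightarrow> int \<Rightarrow> ('c \<Rightarrow> 'r) set \<Rightarrow> ('c \<Rightarrow> 'r) set" where
  "iota T b X = (\<Union>s\<in>X. cls_le T b s)"  \<comment> \<open>\<open>FH\<^sup>b\<^sup>-\<^sup>1 \<rightarrow> FH\<^sup>b\<close>\<close>

definition iota_lim :: "('c, 'r::ring_1) floer_data \<Rightarrow> ('c \<Rightarrow> 'r) set \<Rightarrow> ('c \<Rightarrow> 'r) set" where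
  "iota_lim T X = (\<Union>s\<in>X. cls T s)"  \<comment> \<open>\<open>FH\<^sup>b \<rightarrow> FH\<close>\<close>

definition proj :: "('c, 'r::ring_1) floer_data \<Rightarrow> int \<Rightarrow> ('c \<Rightarrow> 'r) set \<Rightarrow> ('c \<Rightarrow> 'r) set" where
  "proj T b X = (\<Union>s\<in>X. cls_win T b b (trunc T b s))"  \<comment> \<open>\<open>FH\<^sup>b \<rightarrow> FH\<^sup>b\<^sub>b\<close>\<close>

definition conn :: "('c, 'r::ring_1) floer_data \<Rightarrow> int \<Rightarrow> ('c \<Rightarrow> 'r) set \<Rightarrow> ('c \<Rightarrow> 'r) set" where
  "conn T b X = (\<Union>n\<in>X. cls_le T (b - 1) (diff T n))"  \<comment> \<open>\<open>FH\<^sup>b\<^sub>b \<rightarrow> FH\<^sup>b\<^sup>-\<^sup>1\<close>\<close>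

definition aleph_at :: "('c, 'r::ring_1) floer_data \<Rightarrow> int \<Rightarrow> ('r, ('c \<Rightarrow> 'r) set) rmod" where
  "aleph_at T b = (FHwin T b b)
     \<lparr>rcarrier := {X \<in> rcarrier (FHwin T b b). conn T b X = rzero (FHle T (b - 1))}\<rparr>"

definition K_at :: "('c, 'r::ring_1) floer_data \<Rightarrow> int \<Rightarrow> ('r, ('c \<Rightarrow> 'r) set) rmod" where
  "K_at T b = (FHle T b)
     \<lparr>rcarrier := conn T (b + 1) ` rcarrier (FHwin T (b + 1) (b + 1))\<rparr>"

definition im_iota :: "('c, 'r::ring_1) floer_data \<Rightarrow> int \<Rightarrow> ('r, ('c \<Rightarrow> 'r) set) rmod" where
  "im_iota T b = (FHle T b)\<lparr>rcarrier := iota T b ` rcarrier (FHle T (b - 1))\<rparr>"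

definition aleph :: "('c, 'r::ring_1) floer_data \<Rightarrow> ('r, int \<Rightarrow> ('c \<Rightarrow> 'r) set) rmod" where
  "aleph T = bounded_sums (aleph_at T)"

definition K_sums :: "('c, 'r::ring_1) floer_data \<Rightarrow> ('r, int \<Rightarrow> ('c \<Rightarrow> 'r) set) rmod" where
  "K_sums T = bounded_sums (K_at T)"

definition F_sums :: "('c, 'r::ring_1) floer_data \<Rightarrow> ('r, int \<Rightarrow> ('c \<Rightarrow> 'r) set) rmod" where
  "F_sums T = bounded_sums (\<lambda>b. FHwin T b b)"

definition conn_sums ::
  "('c, 'r::ring_1) floer_data \<Rightarrow> (int \<Rightarrow> ('c \<Rightarrow> 'r) set) \<Rightarrow> int \<Rightarrow> ('c \<Rightarrow> 'r) set" where
  "conn_sums T \<eta> = (\<lambda>b. conn T (b + 1) (\<eta> (b + 1)))"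

text \<open>\<open>\<rho>(0) = 0\<close> and \<open>j(0) = 0\<close> are part of linearity.\<close>

definition linear_sections ::
  "('c, 'r::ring_1) floer_data \<Rightarrow> (int \<Rightarrow> ('c \<Rightarrow> 'r) set \<Rightarrow> ('c \<Rightarrow> 'r) set)
    \<Rightarrow> (int \<Rightarrow> ('c \<Rightarrow> 'r) set \<Rightarrow> ('c \<Rightarrow> 'r) set) \<Rightarrow> bool" where
  "linear_sections T \<rho> j \<longleftrightarrow> (\<forall>b.
     \<rho> b \<in> rmod_hom (aleph_at T b) (FHle T b) \<and>
     (\<forall>X\<in>rcarrier (aleph_at T b). proj T b (\<rho> b X) = X) \<and>
     j b \<in> rmod_hom (im_iota T b) (FHle T (b - 1)) \<and>
     (\<forall>Y\<in>rcarrier (im_iota T b). iota T b (j b Y) = Y))"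

text \<open>The value does not depend on the upper bound \<open>b0\<close> nor on the representing cycles.\<close>

definition Psi ::
  "('c, 'r::ring_1) floer_data \<Rightarrow> (int \<Rightarrow> ('c \<Rightarrow> 'r) set \<Rightarrow> ('c \<Rightarrow> 'r) set)
    \<Rightarrow> (int \<Rightarrow> ('c \<Rightarrow> 'r) set) \<Rightarrow> ('c \<Rightarrow> 'r) set" where
  "Psi T \<rho> \<eta> = (THE X. \<exists>b0 s.
     (\<forall>b>b0. \<eta> b = rzero (aleph_at T b)) \<and>
     (\<forall>b\<le>b0. s b \<in> cycles (FCle T b) (diff T) \<and> cls_le T b (s b) = \<rho> b (\<eta> b)) \<and>
     X = cls T (series T b0 s))"

text \<open>The downward recursion determines \<open>\<sigma>\<close> and \<open>\<eta>\<close> from \<open>b0\<close> on; enlarging \<open>b0\<close> only adds zeros.\<close>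

definition Phi ::
  "('c, 'r::ring_1) floer_data \<Rightarrow> (int \<Rightarrow> ('c \<Rightarrow> 'r) set \<Rightarrow> ('c \<Rightarrow> 'r) set)
    \<Rightarrow> (int \<Rightarrow> ('c \<Rightarrow> 'r) set \<Rightarrow> ('c \<Rightarrow> 'r) set)
    \<Rightarrow> (int \<Rightarrow> ('c \<Rightarrow> 'r) set) \<Rightarrow> int \<Rightarrow> ('c \<Rightarrow> 'r) set" where
  "Phi T \<rho> j \<kappa> = (THE \<eta>. \<exists>b0 \<sigma>.
     (\<forall>b>b0. \<kappa> b = rzero (K_at T b) \<and> \<eta> b = rzero (aleph_at T b)) \<and>
     \<sigma> b0 = \<kappa> b0 \<and>
     (\<forall>b\<le>b0. \<eta> b = proj T b (\<sigma> b) \<and>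
        \<sigma> (b - 1) = radd (FHle T (b - 1))
                      (j b (rminus (FHle T b) (\<sigma> b) (\<rho> b (\<eta> b)))) (\<kappa> (b - 1))))"

definition bdry ::
  "('c, 'r::ring_1) floer_data \<Rightarrow> (int \<Rightarrow> ('c \<Rightarrow> 'r) set \<Rightarrow> ('c \<Rightarrow> 'r) set)
    \<Rightarrow> (int \<Rightarrow> ('c \<Rightarrow> 'r) set \<Rightarrow> ('c \<Rightarrow> 'r) set)
    \<Rightarrow> (int \<Rightarrow> ('c \<Rightarrow> 'r) set) \<Rightarrow> int \<Rightarrow> ('c \<Rightarrow> 'r) set" where
  "bdry T \<rho> j = Phi T \<rho> j \<circ> conn_sums T"


section \<open>Filtrations\<close>

definition FH_filt :: "('c, 'r::ring_1) floer_data \<Rightarrow> int \<Rightarrow> ('c \<Rightarrow> 'r) set set" where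
  "FH_filt T p = iota_lim T ` rcarrier (FHle T p)"

definition HF_filt ::
  "('c, 'r::ring_1) floer_data \<Rightarrow> (int \<Rightarrow> ('c \<Rightarrow> 'r) set \<Rightarrow> ('c \<Rightarrow> 'r) set)
    \<Rightarrow> (int \<Rightarrow> ('c \<Rightarrow> 'r) set \<Rightarrow> ('c \<Rightarrow> 'r) set)
    \<Rightarrow> int \<Rightarrow> (int \<Rightarrow> ('c \<Rightarrow> 'r) set) set set" where
  "HF_filt T \<rho> j p = hclass (F_sums T) (bdry T \<rho> j) `
     {\<eta> \<in> cycles (F_sums T) (bdry T \<rho> j). \<forall>b>p. \<eta> b = rzero (FHwin T b b)}"

end

theory Submission
  imports Defs "HOL-Library.Function_Algebras"
begin

text \<open>
  Exactness of the sequences \<open>FH\<^sup>b\<^sup>-\<^sup>1 \<rightarrow> FH\<^sup>b \<rightarrow> FH\<^sup>b\<^sub>b \<rightarrow> FH\<^sup>b\<^sup>-\<^sup>1\<close> shows that the recursion behind \<open>\<Phi>\<close>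
  satisfies \<open>\<sigma>\<^sup>b = \<rho>(\<eta>\<^sup>b) + \<iota> \<sigma>\<^sup>b\<^sup>-\<^sup>1\<close>, because \<open>\<iota>\<close> kills \<open>K\<^sup>b\<^sup>-\<^sup>1\<close>.  Choosing chains that realise these
  equations and adding them up, which is possible since \<open>FC\<close> is complete, gives
  \<open>\<sigma>\<^sup>b = [\<Sum>a\<le>b. s\<^sup>a]\<^sup>b\<close> with \<open>[s\<^sup>a]\<^sup>a = \<rho>(\<eta>\<^sup>a)\<close>.  Everything follows from this formula.  With all \<open>\<eta>\<^sup>b = 0\<close>
  it yields \<open>\<sigma> = 0\<close>, so \<open>\<Phi>\<close> is injective and \<open>ker \<partial> = ker \<delta> = \<aleph>\<close>.  Above the top index, where
  \<open>\<sigma>\<^sup>b = 0\<close>, it yields \<open>\<Psi> \<circ> \<Phi> = 0\<close>.  Started at the class of a cycle it yields a preimage under \<open>\<Psi>\<close>.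
  Conversely, if \<open>\<Psi> \<eta> = 0\<close>, then the partial sums \<open>[\<Sum>a\<le>b. s\<^sup>a]\<^sup>b\<close> solve the recursion for some
  \<open>\<kappa> \<in> K\<close>, so \<open>\<eta> = \<Phi> \<kappa>\<close>.  Linear sections exist since by Zorn's lemma every submodule over a
  semisimple ring has a complement.
\<close>

section \<open>Right modules\<close>

text \<open>Negation is scaling by \<open>- 1\<close>: the inverse law follows from
  \<open>scale_plus\<close> and \<open>scale_0\<close>.\<close>

locale right_module =
  fixes M :: "('r::ring_1, 'x) rmod"
  assumes zero_closed [simp, intro]: "rzero M \<in> rcarrier M"
    and add_closed [simp, intro]:
      "x \<in> rcarrier M \<Longrightarrow> y \<in> rcarrier M \<Longrightarrow> radd M x y \<in> rcarrier M"
    and scale_closed [simp, intro]: "x \<in> rcarrier M \<Longrightarrow> rscale M x r \<in> rcarrier M"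
    and add_assoc: "x \<in> rcarrier M \<Longrightarrow> y \<in> rcarrier M \<Longrightarrow> z \<in> rcarrier M \<Longrightarrow>
      radd M (radd M x y) z = radd M x (radd M y z)"
    and add_comm: "x \<in> rcarrier M \<Longrightarrow> y \<in> rcarrier M \<Longrightarrow> radd M x y = radd M y x"
    and zero_left [simp]: "x \<in> rcarrier M \<Longrightarrow> radd M (rzero M) x = x"
    and scale_add: "x \<in> rcarrier M \<Longrightarrow> y \<in> rcarrier M \<Longrightarrow>
      rscale M (radd M x y) r = radd M (rscale M x r) (rscale M y r)"
    and scale_plus: "x \<in> rcarrier M \<Longrightarrow>
      rscale M x (r + s) = radd M (rscale M x r) (rscale M x s)"
    and scale_mult: "x \<in> rcarrier M \<Longrightarrow> rscale M (rscale M x r) s = rscale M x (r * s)"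
    and scale_one [simp]: "x \<in> rcarrier M \<Longrightarrow> rscale M x 1 = x"
    and scale_0 [simp]: "x \<in> rcarrier M \<Longrightarrow> rscale M x 0 = rzero M"

definition rsubmodule :: "('r::ring_1, 'x) rmod \<Rightarrow> 'x set \<Rightarrow> bool" where
  "rsubmodule M N \<longleftrightarrow> N \<subseteq> rcarrier M \<and> rzero M \<in> N \<and>
     (\<forall>x\<in>N. \<forall>y\<in>N. radd M x y \<in> N) \<and> (\<forall>x\<in>N. \<forall>r. rscale M x r \<in> N)"

context right_module
begin

lemma zero_right [simp]: "x \<in> rcarrier M \<Longrightarrow> radd M x (rzero M) = x"
  using add_comm[of x "rzero M"] by simp

lemma zero_scale [simp]: "rscale M (rzero M) r = rzero M"
  using scale_mult[of "rzero M" 0 r] by simp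

lemma minus_closed [simp, intro]:
  "x \<in> rcarrier M \<Longrightarrow> y \<in> rcarrier M \<Longrightarrow> rminus M x y \<in> rcarrier M"
  by (simp add: rminus_def)

lemma add_neg [simp]: "x \<in> rcarrier M \<Longrightarrow> radd M x (rscale M x (- 1)) = rzero M"
  using scale_plus[of x 1 "- 1"] by simp

lemma add_left_comm:
  "x \<in> rcarrier M \<Longrightarrow> y \<in> rcarrier M \<Longrightarrow> z \<in> rcarrier M \<Longrightarrow>
    radd M x (radd M y z) = radd M y (radd M x z)"
  by (metis add_assoc add_comm)

lemma add_4:
  assumes "x \<in> rcarrier M" "y \<in> rcarrier M" "z \<in> rcarrier M" "w \<in> rcarrier M"
  shows "radd M (radd M x y) (radd M z w) = radd M (radd M x z) (radd M y w)"
  using assms by (simp add: add_assoc add_left_comm[of y z w])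

lemma minus_self [simp]: "x \<in> rcarrier M \<Longrightarrow> rminus M x x = rzero M"
  by (simp add: rminus_def)

lemma minus_add:
  assumes "x \<in> rcarrier M" "y \<in> rcarrier M"
  shows "radd M (rminus M x y) y = x"
proof -
  have "radd M (rminus M x y) y = radd M x (radd M (rscale M y (- 1)) y)"
    using assms by (simp add: rminus_def add_assoc)
  also have "radd M (rscale M y (- 1)) y = rzero M"
    using assms add_comm[of "rscale M y (- 1)" y] by simp
  finally show ?thesis using assms by simp
qed

lemma add_cancel_left:
  assumes "x \<in> rcarrier M" "y \<in> rcarrier M" "z \<in> rcarrier M"
  shows "radd M x y = radd M x z \<longleftrightarrow> y = z"
proof
  assume eq: "radd M x y = radd M x z"
  have "y = radd M (rscale M x (- 1)) (radd M x y)" if "y \<in> rcarrier M" for y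
    using assms(1) that add_comm[of "rscale M x (- 1)" x] add_assoc[of "rscale M x (- 1)" x y]
    by simp
  then show "y = z" using eq assms by metis
qed auto

lemma minus_eq_iff:
  assumes "x \<in> rcarrier M" "y \<in> rcarrier M" "z \<in> rcarrier M"
  shows "rminus M x y = z \<longleftrightarrow> x = radd M y z"
proof -
  have "radd M y (rminus M x y) = x"
    using assms minus_add add_comm by (metis minus_closed)
  then show ?thesis
    using add_cancel_left[of y "rminus M x y" z] assms by auto
qed

lemma minus_eq_zero_iff:
  "x \<in> rcarrier M \<Longrightarrow> y \<in> rcarrier M \<Longrightarrow> rminus M x y = rzero M \<longleftrightarrow> x = y"
  using minus_eq_iff by auto

lemma right_module_sub:
  assumes "rsubmodule M N"
  shows "right_module (M\<lparr>rcarrier := N\<rparr>)"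
  using assms unfolding rsubmodule_def
  by unfold_locales (auto simp: subset_iff add_assoc scale_add scale_plus scale_mult
      intro: add_comm)

lemma rsubmodule_minus:
  "rsubmodule M N \<Longrightarrow> x \<in> N \<Longrightarrow> y \<in> N \<Longrightarrow> rminus M x y \<in> N"
  by (simp add: rsubmodule_def rminus_def)

end

section \<open>Homomorphisms, their kernels and images\<close>

lemma rmod_homD:
  assumes "h \<in> rmod_hom M N" "x \<in> rcarrier M"
  shows rmod_hom_closed: "h x \<in> rcarrier N"
    and rmod_hom_add: "y \<in> rcarrier M \<Longrightarrow> h (radd M x y) = radd N (h x) (h y)"
    and rmod_hom_scale: "h (rscale M x r) = rscale N (h x) r"
  using assms by (auto simp: rmod_hom_def)

lemma rmod_hom_zero:
  assumes "right_module M" "right_module N" "h \<in> rmod_hom M N"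
  shows "h (rzero M) = rzero N"
  using rmod_hom_scale[OF assms(3), of "rzero M" 0] assms
  by (simp add: right_module.zero_closed right_module.scale_0 rmod_hom_closed)

lemma rmod_hom_minus:
  assumes "right_module M" "h \<in> rmod_hom M N" "x \<in> rcarrier M" "y \<in> rcarrier M"
  shows "h (rminus M x y) = rminus N (h x) (h y)"
  using assms by (simp add: rminus_def rmod_hom_add rmod_hom_scale right_module.scale_closed)

lemma rmod_hom_comp:
  "h \<in> rmod_hom M N \<Longrightarrow> k \<in> rmod_hom N P \<Longrightarrow> k \<circ> h \<in> rmod_hom M P"
  by (simp add: rmod_hom_def)

lemma rmod_hom_diff:
  assumes N: "right_module N" and h: "h \<in> rmod_hom M N" and k: "k \<in> rmod_hom M N"
  shows "(\<lambda>x. rminus N (h x) (k x)) \<in> rmod_hom M N"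
proof -
  interpret right_module N by fact
  show ?thesis
    using h k unfolding rmod_hom_def rminus_def
    by (simp add: add_4 scale_add scale_mult)
qed

lemma rsubmodule_kernel:
  assumes "right_module M" "right_module N" "h \<in> rmod_hom M N"
  shows "rsubmodule M {x \<in> rcarrier M. h x = rzero N}"
  using assms rmod_hom_zero[OF assms]
  by (auto simp: rsubmodule_def right_module.zero_closed right_module.add_closed
      right_module.scale_closed rmod_hom_add rmod_hom_scale right_module.zero_left
      right_module.zero_scale)

lemma rsubmodule_image:
  assumes "right_module M" "right_module N" "h \<in> rmod_hom M N"
  shows "rsubmodule N (h ` rcarrier M)"
  unfolding rsubmodule_def
proof (intro conjI ballI allI subsetI)
  show "rzero N \<in> h ` rcarrier M"
    using rmod_hom_zero[OF assms] right_module.zero_closed[OF assms(1)] by (metis imageI)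
next
  fix x y assume "x \<in> h ` rcarrier M" "y \<in> h ` rcarrier M"
  then obtain u v where "u \<in> rcarrier M" "x = h u" "v \<in> rcarrier M" "y = h v" by blast
  then show "radd N x y \<in> h ` rcarrier M"
    using rmod_hom_add[OF assms(3)] right_module.add_closed[OF assms(1)] by (metis imageI)
next
  fix x r assume "x \<in> h ` rcarrier M"
  then obtain u where "u \<in> rcarrier M" "x = h u" by blast
  then show "rscale N x r \<in> h ` rcarrier M"
    using rmod_hom_scale[OF assms(3)] right_module.scale_closed[OF assms(1)] by (metis imageI)
qed (use assms rmod_hom_closed in fastforce)

section \<open>Quotients and homology\<close>

text \<open>Operations on cosets are unions over representatives; such a union collapses to one
  member once all members agree.\<close>

lemma UN_const: "X \<noteq> {} \<Longrightarrow> (\<And>x. x \<in> X \<Longrightarrow> F x = A) \<Longrightarrow> (\<Union>x\<in>X. F x) = A"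
  by auto

locale right_submodule = right_module +
  fixes N
  assumes sub: "rsubmodule M N"
begin

lemma N_carrier: "n \<in> N \<Longrightarrow> n \<in> rcarrier M"
  using sub by (auto simp: rsubmodule_def)

lemma N_add: "n \<in> N \<Longrightarrow> m \<in> N \<Longrightarrow> radd M n m \<in> N"
  using sub by (auto simp: rsubmodule_def)

lemma N_scale: "n \<in> N \<Longrightarrow> rscale M n r \<in> N"
  using sub by (auto simp: rsubmodule_def)

lemma N_zero: "rzero M \<in> N"
  using sub by (auto simp: rsubmodule_def)

lemma rcoset_self: "x \<in> rcarrier M \<Longrightarrow> x \<in> rcoset M N x"
  using N_zero unfolding rcoset_def by (metis image_eqI zero_right)

lemma rcoset_add_N:
  assumes "x \<in> rcarrier M" "n \<in> N"
  shows "rcoset M N (radd M x n) = rcoset M N x"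
proof (intro equalityI subsetI)
  fix z assume "z \<in> rcoset M N (radd M x n)"
  then obtain m where "m \<in> N" "z = radd M (radd M x n) m" by (auto simp: rcoset_def)
  then have "z = radd M x (radd M n m)" using assms by (simp add: add_assoc N_carrier)
  then show "z \<in> rcoset M N x" using N_add assms \<open>m \<in> N\<close> by (auto simp: rcoset_def)
next
  fix z assume "z \<in> rcoset M N x"
  then obtain m where m: "m \<in> N" "z = radd M x m" by (auto simp: rcoset_def)
  have "radd M n (rminus M m n) = m"
    using minus_eq_iff[of m n "rminus M m n"] m(1) assms(2) by (simp add: N_carrier)
  then have "z = radd M (radd M x n) (rminus M m n)"
    using m assms by (simp add: add_assoc N_carrier)
  then show "z \<in> rcoset M N (radd M x n)"
    using rsubmodule_minus[OF sub m(1) assms(2)] by (auto simp: rcoset_def)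
qed

lemma rcoset_eq_iff:
  assumes "x \<in> rcarrier M" "y \<in> rcarrier M"
  shows "rcoset M N x = rcoset M N y \<longleftrightarrow> rminus M x y \<in> N"
proof
  assume "rcoset M N x = rcoset M N y"
  then obtain n where n: "n \<in> N" "x = radd M y n"
    using rcoset_self[of x] assms by (auto simp: rcoset_def)
  then show "rminus M x y \<in> N"
    using minus_eq_iff[of x y n] assms by (simp add: N_carrier)
next
  assume n: "rminus M x y \<in> N"
  have "x = radd M y (rminus M x y)"
    using minus_eq_iff[of x y "rminus M x y"] assms by simp
  then show "rcoset M N x = rcoset M N y"
    using rcoset_add_N[OF assms(2) n] by simp
qed

lemma rquot_add:
  assumes "x \<in> rcarrier M" "y \<in> rcarrier M"
  shows "radd (rquot M N) (rcoset M N x) (rcoset M N y) = rcoset M N (radd M x y)"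
proof -
  have "rcoset M N (radd M x' y') = rcoset M N (radd M x y)"
    if "x' \<in> rcoset M N x" "y' \<in> rcoset M N y" for x' y'
  proof -
    obtain n m where nm: "n \<in> N" "m \<in> N" "x' = radd M x n" "y' = radd M y m"
      using \<open>x' \<in> _\<close> \<open>y' \<in> _\<close> by (auto simp: rcoset_def)
    then have "radd M x' y' = radd M (radd M x y) (radd M n m)"
      using assms by (simp add: add_4 N_carrier)
    then show ?thesis using rcoset_add_N nm N_add assms by simp
  qed
  moreover have "rcoset M N x \<noteq> {}" "rcoset M N y \<noteq> {}" using rcoset_self assms by blast+
  ultimately have "(\<Union>x'\<in>rcoset M N x. \<Union>y'\<in>rcoset M N y. rcoset M N (radd M x' y')) =
      rcoset M N (radd M x y)"
    by (intro UN_const) blast+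
  then show ?thesis by (simp add: rquot_def)
qed

lemma rquot_scale:
  assumes "x \<in> rcarrier M"
  shows "rscale (rquot M N) (rcoset M N x) r = rcoset M N (rscale M x r)"
proof -
  have "rcoset M N (rscale M x' r) = rcoset M N (rscale M x r)"
    if x': "x' \<in> rcoset M N x" for x'
  proof -
    obtain n where "n \<in> N" "x' = radd M x n"
      using x' by (auto simp: rcoset_def)
    then show ?thesis using assms rcoset_add_N N_scale by (simp add: scale_add N_carrier)
  qed
  moreover have "rcoset M N x \<noteq> {}" using rcoset_self assms by blast
  ultimately have "(\<Union>x'\<in>rcoset M N x. rcoset M N (rscale M x' r)) = rcoset M N (rscale M x r)"
    by (intro UN_const) blast+
  then show ?thesis by (simp add: rquot_def)
qed

lemma rquot_zero: "rzero (rquot M N) = rcoset M N (rzero M)"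
  using N_carrier by (force simp: rquot_def rcoset_def image_iff)

lemma rquot_carrier: "rcarrier (rquot M N) = rcoset M N ` rcarrier M"
  by (simp add: rquot_def)

lemma right_module_rquot: "right_module (rquot M N)"
proof
  fix X Y assume "X \<in> rcarrier (rquot M N)" "Y \<in> rcarrier (rquot M N)"
  then show "radd (rquot M N) X Y = radd (rquot M N) Y X"
    by (auto simp: rquot_carrier rquot_add add_comm)
qed (auto simp: rquot_carrier rquot_zero rquot_add rquot_scale add_assoc scale_add scale_plus
      scale_mult)

end

section \<open>Homology of a module with a differential\<close>

locale chain_module = right_module +
  fixes d
  assumes d_hom: "d \<in> rmod_hom M M"
    and d_d: "x \<in> rcarrier M \<Longrightarrow> d (d x) = rzero M"
begin

lemma cycles_sub: "rsubmodule M (cycles M d)"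
  unfolding cycles_def using rsubmodule_kernel d_hom right_module_axioms by blast

lemma cycles_closed [simp, intro]:
  "rzero M \<in> cycles M d"
  "x \<in> cycles M d \<Longrightarrow> y \<in> cycles M d \<Longrightarrow> radd M x y \<in> cycles M d"
  "x \<in> cycles M d \<Longrightarrow> rscale M x r \<in> cycles M d"
  "x \<in> cycles M d \<Longrightarrow> y \<in> cycles M d \<Longrightarrow> rminus M x y \<in> cycles M d"
  using cycles_sub rsubmodule_minus[OF cycles_sub] unfolding rsubmodule_def by blast+

lemma boundary_cycle [simp, intro]: "x \<in> rcarrier M \<Longrightarrow> d x \<in> cycles M d"
  using rmod_hom_closed[OF d_hom] d_d unfolding cycles_def by blast

sublocale H: right_submodule "M\<lparr>rcarrier := cycles M d\<rparr>" "d ` rcarrier M"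
proof -
  have "rsubmodule M (d ` rcarrier M)"
    using rsubmodule_image right_module_axioms d_hom by blast
  then have "rsubmodule (M\<lparr>rcarrier := cycles M d\<rparr>) (d ` rcarrier M)"
    by (auto simp: rsubmodule_def)
  then show "right_submodule (M\<lparr>rcarrier := cycles M d\<rparr>) (d ` rcarrier M)"
    using right_module_sub[OF cycles_sub]
    by (simp add: right_submodule_def right_submodule_axioms_def)
qed

text \<open>\<open>rcoset\<close> uses the addition of the module and not its carrier, so passing to
  the cycles leaves it unchanged. This transfers the facts about the quotient \<open>H\<close> to
  \<open>hclass\<close>.\<close>

lemma hclass_rcoset: "hclass M d x = rcoset (M\<lparr>rcarrier := cycles M d\<rparr>) (d ` rcarrier M) x"
  by (simp add: hclass_def rcoset_def)

lemma right_module_homology: "right_module (homology M d)"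
  unfolding homology_def by (rule H.right_module_rquot)

lemma homology_carrier: "rcarrier (homology M d) = hclass M d ` cycles M d"
  unfolding homology_def H.rquot_carrier by (simp add: hclass_rcoset image_def)

lemma homology_zero: "rzero (homology M d) = hclass M d (rzero M)"
  unfolding homology_def H.rquot_zero by (simp add: hclass_rcoset)

lemma homology_add:
  "x \<in> cycles M d \<Longrightarrow> y \<in> cycles M d \<Longrightarrow>
    radd (homology M d) (hclass M d x) (hclass M d y) = hclass M d (radd M x y)"
  unfolding homology_def hclass_rcoset using H.rquot_add by simp

lemma homology_scale:
  "x \<in> cycles M d \<Longrightarrow> rscale (homology M d) (hclass M d x) r = hclass M d (rscale M x r)"
  unfolding homology_def hclass_rcoset using H.rquot_scale by simp

lemma hclass_eq_iff:
  "x \<in> cycles M d \<Longrightarrow> y \<in> cycles M d \<Longrightarrow>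
    hclass M d x = hclass M d y \<longleftrightarrow> rminus M x y \<in> d ` rcarrier M"
  unfolding hclass_rcoset using H.rcoset_eq_iff by (simp add: rminus_def)

lemma hclass_self: "x \<in> cycles M d \<Longrightarrow> x \<in> hclass M d x"
  unfolding hclass_rcoset using H.rcoset_self by simp

lemma hclass_member:
  assumes "x \<in> cycles M d" "y \<in> hclass M d x"
  shows "y \<in> cycles M d" "hclass M d y = hclass M d x"
proof -
  obtain u where "u \<in> rcarrier M" "y = radd M x (d u)"
    using assms(2) by (auto simp: hclass_def rcoset_def)
  then show "y \<in> cycles M d" "hclass M d y = hclass M d x"
    using assms H.rcoset_add_N[of x "d u"] by (simp_all add: hclass_rcoset)
qed

text \<open>The tool for evaluating \<open>iota\<close>, \<open>iota_lim\<close>,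
  \<open>proj\<close> and \<open>conn\<close> at the class of a given cycle: it reduces the
  evaluation to independence of the representative.\<close>

lemma UN_hclass:
  assumes x: "x \<in> cycles M d"
    and F: "\<And>y. y \<in> cycles M d \<Longrightarrow> hclass M d y = hclass M d x \<Longrightarrow> F y = F x"
  shows "(\<Union>y\<in>hclass M d x. F y) = F x"
proof (rule UN_const)
  show "hclass M d x \<noteq> {}" using hclass_self[OF x] by blast
  show "F y = F x" if "y \<in> hclass M d x" for y by (intro F hclass_member[OF x that])
qed

text \<open>First isomorphism theorem for cycles modulo boundaries. The values of the isomorphism on
  classes are recorded because the filtration is compared through them.\<close>

lemma homology_iso:
  assumes N: "right_module N"
    and g: "g \<in> rmod_hom (M\<lparr>rcarrier := cycles M d\<rparr>) N"
    and surj: "g ` cycles M d = rcarrier N"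
    and ker: "\<And>x. x \<in> cycles M d \<Longrightarrow> g x = rzero N \<longleftrightarrow> x \<in> d ` rcarrier M"
  shows "\<exists>h \<in> rmod_iso (homology M d) N. \<forall>x\<in>cycles M d. h (hclass M d x) = g x"
proof -
  interpret N: right_module N by fact
  note gD = rmod_homD[OF g, simplified]
  have eq: "g x = g y \<longleftrightarrow> hclass M d x = hclass M d y"
    if "x \<in> cycles M d" "y \<in> cycles M d" for x y
  proof -
    have "g (rminus M x y) = rminus N (g x) (g y)"
      using that by (simp add: rminus_def gD)
    then show ?thesis
      using N.minus_eq_zero_iff[of "g x" "g y"] ker[of "rminus M x y"] that
      by (simp add: gD hclass_eq_iff)
  qed
  \<comment> \<open>An arbitrary representative is taken; by \<open>eq\<close> the value of
    \<open>g\<close> does not depend on it.\<close>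
  define h where "h X = g (SOME x. x \<in> X)" for X
  have h: "h (hclass M d x) = g x" if "x \<in> cycles M d" for x
  proof -
    have "(SOME y. y \<in> hclass M d x) \<in> hclass M d x"
      using hclass_self[OF that] by (rule someI)
    from hclass_member[OF that this] show ?thesis
      unfolding h_def using eq[OF _ that] by simp
  qed
  have "h \<in> rmod_iso (homology M d) N"
    unfolding rmod_iso_def rmod_hom_def bij_betw_def inj_on_def
  proof (intro CollectI conjI ballI allI impI)
    fix X Y r
    assume X: "X \<in> rcarrier (homology M d)"
    then obtain x where x: "x \<in> cycles M d" "X = hclass M d x"
      by (auto simp: homology_carrier)
    show "h X \<in> rcarrier N" "h (rscale (homology M d) X r) = rscale N (h X) r"
      using x by (simp_all add: h gD homology_scale)
    assume Y: "Y \<in> rcarrier (homology M d)"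
    then obtain y where y: "y \<in> cycles M d" "Y = hclass M d y"
      by (auto simp: homology_carrier)
    show "h (radd (homology M d) X Y) = radd N (h X) (h Y)"
      using x y by (simp add: h gD homology_add)
    show "h X = h Y \<Longrightarrow> X = Y"
      using x y eq h by simp
  next
    have "h ` rcarrier (homology M d) = g ` cycles M d"
      unfolding homology_carrier image_image using h by (intro image_cong) auto
    then show "h ` rcarrier (homology M d) = rcarrier N" using surj by simp
  qed
  then show ?thesis using h by blast
qed

end

section \<open>Linear sections over a semisimple ring\<close>

context right_module
begin

text \<open>Zorn's lemma gives \<open>L\<close> maximal among the submodules that meet
  \<open>N\<close> in zero. If some \<open>x\<close> lay outside \<open>N + L\<close>,
  semisimplicity would give a multiple \<open>y\<close> of \<open>x\<close> such that
  \<open>L + yR\<close> still meets \<open>N\<close> in zero, against maximality.\<close>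

lemma complement_exists:
  assumes semi: "semisimple_ring TYPE('r)" and N: "rsubmodule M N"
  shows "\<exists>L. rsubmodule M L \<and> N \<inter> L = {rzero M} \<and>
    (\<forall>x\<in>rcarrier M. \<exists>n\<in>N. \<exists>l\<in>L. x = radd M n l)"
proof -
  define A where "A = {L. rsubmodule M L \<and> N \<inter> L = {rzero M}}"
  have "\<exists>L\<in>A. \<forall>X\<in>A. L \<subseteq> X \<longrightarrow> X = L"
  proof (rule subset_Zorn_nonempty)
    have "{rzero M} \<in> A" using N by (auto simp: A_def rsubmodule_def)
    then show "A \<noteq> {}" by blast
  next
    fix \<C> assume ne: "\<C> \<noteq> {}" and ch: "subset.chain A \<C>"
    have CA: "\<And>L. L \<in> \<C> \<Longrightarrow> L \<in> A"
      and lin: "\<And>L L'. L \<in> \<C> \<Longrightarrow> L' \<in> \<C> \<Longrightarrow> L \<subseteq> L' \<or> L' \<subseteq> L"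
      using ch by (auto simp: subset_chain_def)
    have "rsubmodule M (\<Union>\<C>)"
      unfolding rsubmodule_def
    proof (intro conjI ballI allI)
      show "\<Union>\<C> \<subseteq> rcarrier M" "rzero M \<in> \<Union>\<C>"
        using CA ne unfolding A_def rsubmodule_def by blast+
    next
      fix x y assume "x \<in> \<Union>\<C>" "y \<in> \<Union>\<C>"
      then obtain L where "L \<in> \<C>" "x \<in> L" "y \<in> L" using lin by blast
      then show "radd M x y \<in> \<Union>\<C>" using CA unfolding A_def rsubmodule_def by blast
    next
      fix x r assume "x \<in> \<Union>\<C>"
      then show "rscale M x r \<in> \<Union>\<C>" using CA unfolding A_def rsubmodule_def by blast
    qed
    moreover have "N \<inter> \<Union>\<C> = {rzero M}" using CA ne by (auto simp: A_def)
    ultimately show "\<Union>\<C> \<in> A" by (simp add: A_def)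
  qed
  then obtain L where L: "rsubmodule M L" "N \<inter> L = {rzero M}"
    and max: "\<And>X. X \<in> A \<Longrightarrow> L \<subseteq> X \<Longrightarrow> X = L" by (auto simp: A_def)
  interpret N: right_submodule M N using N by unfold_locales
  interpret L: right_submodule M L using L by unfold_locales
  \<comment> \<open>\<open>S\<close> is the sum \<open>N + L\<close>; the claim is that it is all of
    \<open>M\<close>.\<close>
  define S where "S = {radd M n l | n l. n \<in> N \<and> l \<in> L}"
  have S_mem: "radd M n l \<in> S" if "n \<in> N" "l \<in> L" for n l
    unfolding S_def using that by blast
  have S: "rsubmodule M S"
    unfolding rsubmodule_def
  proof (intro conjI ballI allI)
    show "S \<subseteq> rcarrier M" by (auto simp: S_def N.N_carrier L.N_carrier)
    show "rzero M \<in> S"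
      using S_mem[OF N.N_zero L.N_zero] by simp
  next
    fix x y assume "x \<in> S" "y \<in> S"
    then obtain n l n' l' where "x = radd M n l" "y = radd M n' l'"
      and nl: "n \<in> N" "l \<in> L" "n' \<in> N" "l' \<in> L" by (auto simp: S_def)
    then have "radd M x y = radd M (radd M n n') (radd M l l')"
      by (simp add: add_4 N.N_carrier L.N_carrier)
    then show "radd M x y \<in> S" unfolding S_def using nl N.N_add L.N_add by blast
  next
    fix x r assume "x \<in> S"
    then obtain n l where "x = radd M n l" and nl: "n \<in> N" "l \<in> L" by (auto simp: S_def)
    then have "rscale M x r = radd M (rscale M n r) (rscale M l r)"
      by (simp add: scale_add N.N_carrier L.N_carrier)
    then show "rscale M x r \<in> S" unfolding S_def using nl N.N_scale L.N_scale by blast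
  qed
  then interpret S: right_submodule M S by unfold_locales
  have NS: "n \<in> S" if "n \<in> N" for n
    using S_mem[OF that L.N_zero] N.N_carrier[OF that] by simp
  have LS: "l \<in> S" if "l \<in> L" for l
    using S_mem[OF N.N_zero that] L.N_carrier[OF that] by simp
  have "x \<in> S" if x: "x \<in> rcarrier M" for x
  proof (rule ccontr)
    assume xS: "x \<notin> S"
    define I where "I = {r. rscale M x r \<in> S}"
    have "right_ideal I"
      using x S.N_zero S.N_add S.N_scale
      by (auto simp: right_ideal_def I_def scale_plus scale_mult[symmetric])
    then obtain J where J: "right_ideal J" "I \<inter> J = {0}"
      and dec: "\<forall>x. \<exists>i\<in>I. \<exists>j\<in>J. x = i + j"
      using semi unfolding semisimple_ring_def by meson
    obtain i j where ij: "i \<in> I" "j \<in> J" "1 = i + j" using dec by blast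
    \<comment> \<open>\<open>y\<close> is the part of \<open>x\<close> independent of
      \<open>S\<close>: if a multiple \<open>y r\<close> lies in \<open>S\<close>, then
      \<open>j * r\<close> lies in both \<open>I\<close> and \<open>J\<close> and is zero. Since
      \<open>x i\<close> lies in \<open>S\<close>, \<open>y\<close> itself does not.\<close>
    define y where "y = rscale M x j"
    have y: "y \<in> rcarrier M" using x by (simp add: y_def)
    have "x = radd M (rscale M x i) y"
      using scale_plus[OF x, of i j] ij(3) x by (simp add: y_def)
    then have yS: "y \<notin> S" using xS ij(1) S.N_add unfolding I_def by (metis CollectD)
    \<comment> \<open>The enlarged submodule \<open>L + yR\<close>, which is to contradict
      maximality.\<close>
    define L' where "L' = {radd M l (rscale M y r) | l r. l \<in> L}"
    have mem: "radd M l (rscale M y r) \<in> L'" if "l \<in> L" for l r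
      unfolding L'_def using that by blast
    have LL': "L \<subseteq> L'"
      using mem[of _ 0] y by (auto simp: L.N_carrier)
    have yL': "y \<in> L'"
      using mem[OF L.N_zero, of 1] y by simp
    have "rsubmodule M L'"
      unfolding rsubmodule_def
    proof (intro conjI ballI allI)
      show "L' \<subseteq> rcarrier M" using y by (auto simp: L'_def L.N_carrier)
      show "rzero M \<in> L'" using LL' L.N_zero by blast
    next
      fix u v assume "u \<in> L'" "v \<in> L'"
      then obtain l r l' r' where "u = radd M l (rscale M y r)" "v = radd M l' (rscale M y r')"
        and l: "l \<in> L" "l' \<in> L" by (auto simp: L'_def)
      then have "radd M u v = radd M (radd M l l') (rscale M y (r + r'))"
        using y by (simp add: add_4 L.N_carrier scale_plus)
      then show "radd M u v \<in> L'" unfolding L'_def using l L.N_add by blast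
    next
      fix u s assume "u \<in> L'"
      then obtain l r where "u = radd M l (rscale M y r)" and l: "l \<in> L" by (auto simp: L'_def)
      then have "rscale M u s = radd M (rscale M l s) (rscale M y (r * s))"
        using y by (simp add: L.N_carrier scale_add scale_mult)
      then show "rscale M u s \<in> L'" unfolding L'_def using l L.N_scale by blast
    qed
    moreover have "N \<inter> L' = {rzero M}"
    proof (intro equalityI subsetI)
      fix u assume "u \<in> N \<inter> L'"
      then obtain l r where u: "u \<in> N" "u = radd M l (rscale M y r)" and l: "l \<in> L"
        by (auto simp: L'_def)
      \<comment> \<open>Here \<open>y r\<close> is a difference of elements of \<open>N\<close> and
        \<open>L\<close>, hence lies in \<open>S\<close>, so independence of \<open>y\<close> from
        \<open>S\<close> applies.\<close>
      have "rscale M y r = rminus M u l"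
        using minus_eq_iff[of u l "rscale M y r"] u l y by (simp add: N.N_carrier L.N_carrier)
      then have "rscale M x (j * r) \<in> S"
        using rsubmodule_minus[OF S] NS LS u(1) l x by (simp add: y_def scale_mult)
      moreover have "j * r \<in> J" using J(1) ij(2) by (simp add: right_ideal_def)
      ultimately have "j * r = 0" using J(2) by (auto simp: I_def)
      then have "rscale M y r = rzero M" using x by (simp add: y_def scale_mult)
      then have "u = l" using u(2) l by (simp add: L.N_carrier)
      then show "u \<in> {rzero M}" using u(1) l L(2) by blast
    next
      fix u assume "u \<in> {rzero M}"
      then show "u \<in> N \<inter> L'" using N.N_zero LL' L.N_zero by auto
    qed
    ultimately have "L' = L" using max LL' by (simp add: A_def)
    then show False using yL' yS LS by blast
  qed
  then show ?thesis using L unfolding S_def by blast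
qed

text \<open>A complement \<open>L\<close> of the kernel of \<open>g\<close> is mapped bijectively
  onto the image; the section is the inverse of this bijection.\<close>

lemma linear_section_exists:
  assumes semi: "semisimple_ring TYPE('r)"
    and P: "right_module P" and g: "g \<in> rmod_hom M P"
  shows "\<exists>k \<in> rmod_hom (P\<lparr>rcarrier := g ` rcarrier M\<rparr>) M. \<forall>y\<in>g ` rcarrier M. g (k y) = y"
proof -
  interpret P: right_module P by fact
  note gD = rmod_homD[OF g]
  have g0: "g (rzero M) = rzero P" using rmod_hom_zero right_module_axioms P g by blast
  define N where "N = {x \<in> rcarrier M. g x = rzero P}"
  have "rsubmodule M N"
    unfolding N_def using rsubmodule_kernel right_module_axioms P g by blast
  then obtain L where L: "rsubmodule M L" "N \<inter> L = {rzero M}"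
    and dec: "\<And>x. x \<in> rcarrier M \<Longrightarrow> \<exists>n\<in>N. \<exists>l\<in>L. x = radd M n l"
    using complement_exists[OF semi] by meson
  interpret L: right_submodule M L using L by unfold_locales
  have ex: "\<exists>l. l \<in> L \<and> g l = y" if y: "y \<in> g ` rcarrier M" for y
  proof -
    obtain x where x: "x \<in> rcarrier M" "y = g x" using y by blast
    obtain n l where "n \<in> N" "l \<in> L" "x = radd M n l" using dec[OF x(1)] by blast
    then have "g l = y" using x by (simp add: N_def gD L.N_carrier)
    then show ?thesis using \<open>l \<in> L\<close> by blast
  qed
  have uniq: "l = l'" if "l \<in> L" "l' \<in> L" "g l = g l'" for l l'
  proof -
    have "g (rminus M l l') = rzero P"
      using rmod_hom_minus[OF right_module_axioms g, of l l'] that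
      by (simp add: L.N_carrier gD)
    then have "rminus M l l' \<in> N \<inter> L"
      using rsubmodule_minus[OF L(1)] that by (simp add: N_def L.N_carrier)
    then show ?thesis using L(2) minus_eq_zero_iff that L.N_carrier by auto
  qed
  define k where "k y = (SOME l. l \<in> L \<and> g l = y)" for y
  have k: "k y \<in> L \<and> g (k y) = y" if "y \<in> g ` rcarrier M" for y
    unfolding k_def using ex[OF that] by (rule someI_ex)
  have im: "rsubmodule P (g ` rcarrier M)"
    using rsubmodule_image right_module_axioms P g by blast
  have "k \<in> rmod_hom (P\<lparr>rcarrier := g ` rcarrier M\<rparr>) M"
    unfolding rmod_hom_def
  proof (intro CollectI conjI ballI allI)
    fix x y r
    assume x: "x \<in> rcarrier (P\<lparr>rcarrier := g ` rcarrier M\<rparr>)"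
    then have kx: "k x \<in> L" "g (k x) = x" using k by auto
    show "k x \<in> rcarrier M" using kx L.N_carrier by blast
    \<comment> \<open>Both sides of the equation below lie in \<open>L\<close> and have the same
      image under \<open>g\<close>, so \<open>uniq\<close> identifies them; sums are treated
      alike.\<close>
    have "rscale P x r \<in> g ` rcarrier M" using im x by (auto simp: rsubmodule_def)
    then show "k (rscale (P\<lparr>rcarrier := g ` rcarrier M\<rparr>) x r) = rscale M (k x) r"
      using kx k L.N_scale gD(3)[of "k x" r] L.N_carrier by (intro uniq) auto
    assume y: "y \<in> rcarrier (P\<lparr>rcarrier := g ` rcarrier M\<rparr>)"
    then have ky: "k y \<in> L" "g (k y) = y" using k by auto
    have "radd P x y \<in> g ` rcarrier M" using im x y by (auto simp: rsubmodule_def)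
    then show "k (radd (P\<lparr>rcarrier := g ` rcarrier M\<rparr>) x y) = radd M (k x) (k y)"
      using kx ky k L.N_add gD(2)[of "k x" "k y"] L.N_carrier by (intro uniq) auto
  qed
  then show ?thesis using k by blast
qed

end

section \<open>Bounded-above formal sums\<close>

lemma bounded_sums_right_module:
  assumes "\<And>b. right_module (M b)"
  shows "right_module (bounded_sums M)"
proof -
  interpret right_module "M b" for b by fact
  show ?thesis
  proof
    fix x y assume x: "x \<in> rcarrier (bounded_sums M)" and y: "y \<in> rcarrier (bounded_sums M)"
    obtain p q where "\<forall>b>p. x b = rzero (M b)" "\<forall>b>q. y b = rzero (M b)"
      using x y by (auto simp: bounded_sums_def)
    then have "\<forall>b>max p q. radd (M b) (x b) (y b) = rzero (M b)" by simp
    then show "radd (bounded_sums M) x y \<in> rcarrier (bounded_sums M)"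
      using x y unfolding bounded_sums_def by (auto intro!: exI[of _ "max p q"])
  next
    fix x r assume x: "x \<in> rcarrier (bounded_sums M)"
    then obtain p where "\<forall>b>p. x b = rzero (M b)"
      by (auto simp: bounded_sums_def)
    then have "\<forall>b>p. rscale (M b) (x b) r = rzero (M b)" by simp
    then show "rscale (bounded_sums M) x r \<in> rcarrier (bounded_sums M)"
      using x unfolding bounded_sums_def by auto
  next
    fix x y assume "x \<in> rcarrier (bounded_sums M)" "y \<in> rcarrier (bounded_sums M)"
    then show "radd (bounded_sums M) x y = radd (bounded_sums M) y x"
      using add_comm by (auto simp: bounded_sums_def)
  qed (auto simp: bounded_sums_def add_assoc scale_add scale_plus scale_mult)
qed

section \<open>The complexes of a Floer triple\<close>

text \<open>Turns the module operations on chains into pointwise \<open>+\<close>, \<open>-\<close>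
  and \<open>0\<close>, so that the group laws for functions apply.\<close>

lemma fun_mod_simps [simp]:
  "rcarrier (fun_mod S) = S" "radd (fun_mod S) = (+)" "rzero (fun_mod S) = 0"
  "rscale (fun_mod S) = (\<lambda>s r c. s c * r)" "rminus (fun_mod S) = (-)"
  by (auto simp: fun_mod_def rminus_def fun_eq_iff)

lemma right_module_fun_mod:
  assumes "0 \<in> S" "\<And>s t. s \<in> S \<Longrightarrow> t \<in> S \<Longrightarrow> s + t \<in> S"
    and "\<And>s r. s \<in> S \<Longrightarrow> (\<lambda>c. s c * r) \<in> S"
  shows "right_module (fun_mod S)"
  using assms by unfold_locales (auto simp: fun_eq_iff algebra_simps)

lemma FCle_simps [simp]:
  "radd (FCle T b) = (+)" "rzero (FCle T b) = 0"
  "rscale (FCle T b) = (\<lambda>s r c. s c * r)" "rminus (FCle T b) = (-)"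
  by (simp_all add: FCle_def)

lemma FCwin_simps [simp]:
  "radd (FCwin T a b) = (+)" "rzero (FCwin T a b) = 0"
  "rscale (FCwin T a b) = (\<lambda>s r c. s c * r)" "rminus (FCwin T a b) = (-)"
  by (simp_all add: FCwin_def)

lemma FC_simps [simp]:
  "radd (FC T) = (+)" "rzero (FC T) = 0"
  "rscale (FC T) = (\<lambda>s r c. s c * r)" "rminus (FC T) = (-)"
  by (simp_all add: FC_def)

lemma FC_carrier: "rcarrier (FC T) = (\<Union>b. rcarrier (FCle T b))"
  by (simp add: FC_def)

lemma FCle_iff: "s \<in> rcarrier (FCle T b) \<longleftrightarrow> (\<forall>c. s c \<noteq> 0 \<longrightarrow> c \<in> gens T \<and> level T c \<le> b)"
  by (simp add: FCle_def)

lemma FCle_iff_zero: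
  "s \<in> rcarrier (FCle T b) \<longleftrightarrow> (\<forall>c. c \<notin> gens T \<or> b < level T c \<longrightarrow> s c = 0)"
  unfolding FCle_iff by (metis not_le)

lemma FCwin_iff:
  "s \<in> rcarrier (FCwin T a b) \<longleftrightarrow> (\<forall>c. s c \<noteq> 0 \<longrightarrow> c \<in> gens T \<and> a \<le> level T c \<and> level T c \<le> b)"
  by (simp add: FCwin_def)

lemma FCwin_iff_zero:
  "s \<in> rcarrier (FCwin T a b) \<longleftrightarrow>
    (\<forall>c. c \<notin> gens T \<or> level T c < a \<or> b < level T c \<longrightarrow> s c = 0)"
  unfolding FCwin_iff by (metis not_le)

lemma FCle_closed [simp, intro]:
  "0 \<in> rcarrier (FCle T b)"
  "s \<in> rcarrier (FCle T b) \<Longrightarrow> t \<in> rcarrier (FCle T b) \<Longrightarrow> s + t \<in> rcarrier (FCle T b)"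
  "s \<in> rcarrier (FCle T b) \<Longrightarrow> t \<in> rcarrier (FCle T b) \<Longrightarrow> s - t \<in> rcarrier (FCle T b)"
  "s \<in> rcarrier (FCle T b) \<Longrightarrow> (\<lambda>c. s c * r) \<in> rcarrier (FCle T b)"
  by (auto simp: FCle_iff_zero)

lemma FCle_mono: "a \<le> b \<Longrightarrow> s \<in> rcarrier (FCle T a) \<Longrightarrow> s \<in> rcarrier (FCle T b)"
  by (fastforce simp: FCle_iff)

lemma FCwin_le: "s \<in> rcarrier (FCwin T a b) \<Longrightarrow> s \<in> rcarrier (FCle T b)"
  by (fastforce simp: FCle_iff FCwin_iff)

lemma FC_le: "s \<in> rcarrier (FCle T b) \<Longrightarrow> s \<in> rcarrier (FC T)"
  by (auto simp: FC_carrier)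

lemma trunc_linear:
  "trunc T a (s + t) = trunc T a s + trunc T a t"
  "trunc T a (s - t) = trunc T a s - trunc T a t"
  "trunc T a (\<lambda>c. s c * r) = (\<lambda>c. trunc T a s c * r)"
  "trunc T a 0 = 0"
  by (auto simp: trunc_def fun_eq_iff)

lemma trunc_win: "s \<in> rcarrier (FCle T b) \<Longrightarrow> trunc T a s \<in> rcarrier (FCwin T a b)"
  by (auto simp: FCle_iff FCwin_iff trunc_def)

lemma trunc_id: "s \<in> rcarrier (FCwin T a b) \<Longrightarrow> trunc T a s = s"
  by (fastforce simp: FCwin_iff trunc_def)

lemma minus_trunc: "s \<in> rcarrier (FCle T b) \<Longrightarrow> s - trunc T b s \<in> rcarrier (FCle T (b - 1))"
  by (auto simp: FCle_iff trunc_def)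

text \<open>Levels are integers, so losing the part at level \<open>b\<close> means being bounded by
  \<open>b - 1\<close>. This is exactness of the sequence of chain modules in the middle.\<close>

lemma trunc_eq_0_iff:
  "s \<in> rcarrier (FCle T b) \<Longrightarrow> trunc T b s = 0 \<longleftrightarrow> s \<in> rcarrier (FCle T (b - 1))"
  unfolding FCle_iff_zero trunc_def fun_eq_iff by (auto simp: not_le)

lemma right_module_FCle: "right_module (FCle T b)"
proof -
  have "right_module (fun_mod (rcarrier (FCle T b)))"
    by (rule right_module_fun_mod) auto
  then show ?thesis by (simp add: FCle_def)
qed

lemma right_module_FCwin: "right_module (FCwin T a b)"
proof -
  have "right_module (fun_mod (rcarrier (FCwin T a b)))"
    by (rule right_module_fun_mod) (auto simp: FCwin_iff_zero)
  then show ?thesis by (simp add: FCwin_def)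
qed

lemma right_module_FC: "right_module (FC T)"
  unfolding FC_def
proof (rule right_module_fun_mod)
  fix s t assume "s \<in> (\<Union>b. rcarrier (FCle T b))" "t \<in> (\<Union>b. rcarrier (FCle T b))"
  then obtain a b where "s \<in> rcarrier (FCle T a)" "t \<in> rcarrier (FCle T b)" by blast
  then have "s + t \<in> rcarrier (FCle T (max a b))"
    using FCle_mono[of a "max a b" s] FCle_mono[of b "max a b" t] by simp
  then show "s + t \<in> (\<Union>b. rcarrier (FCle T b))" by blast
qed (use FCle_closed in blast)+

section \<open>The differential of a Floer triple\<close>

locale floer =
  fixes T :: "('c, 'r::ring_1) floer_data"
  assumes floer: "floer_triple T"
begin

abbreviation "C b \<equiv> rcarrier (FCle T b)"
abbreviation "Z b \<equiv> cycles (FCle T b) (diff T)"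
abbreviation "Cw b \<equiv> rcarrier (FCwin T b b)"
abbreviation "Zw b \<equiv> cycles (FCwin T b b) (diff_win T b)"

text \<open>A finite index set that contains all generators contributing to the coefficient of
  \<open>d s\<close> at \<open>y\<close>, when \<open>a\<close> is the level of \<open>y\<close> and
  \<open>s\<close> is bounded by \<open>b\<close>.\<close>

definition "window a b = {x \<in> gens T. a \<le> level T x \<and> level T x \<le> b}"

lemma finite_window [simp]: "finite (window a b)"
proof -
  have "window a b = (\<Union>i\<in>{a..b}. {c \<in> gens T. level T c = i})" by (auto simp: window_def)
  then show ?thesis using floer by (simp add: floer_triple_def)
qed

lemma level_le:
  "y \<in> gens T \<Longrightarrow> x \<in> gens T \<Longrightarrow> coef T y x \<noteq> 0 \<Longrightarrow> level T y \<le> level T x"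
  using floer by (auto simp: floer_triple_def)

text \<open>\<open>diff\<close> sums over a set that varies with \<open>s\<close>. An index set
  depending only on \<open>y\<close> and \<open>b\<close> reduces linearity and
  \<open>d d = 0\<close> to rearranging finite sums.\<close>

lemma diff_apply:
  assumes "s \<in> C b" "y \<in> gens T"
  shows "diff T s y = (\<Sum>x\<in>window (level T y) b. coef T y x * s x)"
proof -
  have "{x. x \<in> gens T \<and> coef T y x * s x \<noteq> 0} \<subseteq> window (level T y) b"
  proof
    fix x assume "x \<in> {x. x \<in> gens T \<and> coef T y x * s x \<noteq> 0}"
    then have "x \<in> gens T" "coef T y x \<noteq> 0" "s x \<noteq> 0" by auto
    then show "x \<in> window (level T y) b"
      using assms level_le[of y x] by (simp add: window_def FCle_iff)
  qed
  then have "(\<Sum>x | x \<in> gens T \<and> coef T y x * s x \<noteq> 0. coef T y x * s x) =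
      (\<Sum>x\<in>window (level T y) b. coef T y x * s x)"
    by (intro sum.mono_neutral_left finite_window) (auto simp: window_def)
  then show ?thesis using assms by (simp add: diff_def)
qed

lemma diff_off: "y \<notin> gens T \<Longrightarrow> diff T s y = 0"
  by (simp add: diff_def)

lemma diff_closed [simp, intro]:
  assumes "s \<in> C b" shows "diff T s \<in> C b"
  unfolding FCle_iff
proof (intro allI impI)
  fix y assume nz: "diff T s y \<noteq> 0"
  then have y: "y \<in> gens T" using diff_off by blast
  moreover have "window (level T y) b \<noteq> {}"
    using nz diff_apply[OF assms y] by auto
  ultimately show "y \<in> gens T \<and> level T y \<le> b" by (auto simp: window_def)
qed

lemma diff_add:
  assumes "s \<in> C b" "t \<in> C b" shows "diff T (s + t) = diff T s + diff T t"
proof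
  fix y show "diff T (s + t) y = (diff T s + diff T t) y"
    using diff_apply[of _ b y] assms
    by (cases "y \<in> gens T") (simp_all add: diff_off distrib_left sum.distrib)
qed

lemma diff_scale:
  assumes "s \<in> C b" shows "diff T (\<lambda>c. s c * r) = (\<lambda>c. diff T s c * r)"
proof
  fix y show "diff T (\<lambda>c. s c * r) y = diff T s y * r"
    using diff_apply[of _ b y] assms
    by (cases "y \<in> gens T") (simp_all add: diff_off sum_distrib_right mult.assoc)
qed

lemma diff_minus:
  assumes "s \<in> C b" "t \<in> C b" shows "diff T (s - t) = diff T s - diff T t"
proof -
  have "diff T (s - t) + diff T t = diff T s"
    using diff_add[of "s - t" b t] assms by simp
  then show ?thesis by (simp add: eq_diff_eq)
qed

lemma diff_0 [simp]: "diff T 0 = 0"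
  by (simp add: diff_def fun_eq_iff)

text \<open>Both sums are written over the same window, so they can be exchanged; the inner sum of
  products of coefficients then vanishes by the axiom on \<open>coef\<close>.\<close>

lemma diff_diff [simp]:
  assumes "s \<in> C b" shows "diff T (diff T s) = 0"
proof
  fix y show "diff T (diff T s) y = 0 y"
  proof (cases "y \<in> gens T")
    case y: True
    let ?W = "window (level T y) b"
    have inner: "coef T y x * diff T s x = (\<Sum>z\<in>?W. coef T y x * coef T x z * s z)"
      if "x \<in> ?W" for x
    proof -
      have "diff T s x = (\<Sum>z\<in>window (level T x) b. coef T x z * s z)"
        using that assms by (intro diff_apply) (auto simp: window_def)
      \<comment> \<open>The added \<open>z\<close> lie at levels below that of \<open>x\<close>,
        where \<open>coef T x z\<close> vanishes.\<close>
      also have "\<dots> = (\<Sum>z\<in>?W. coef T x z * s z)"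
      proof (rule sum.mono_neutral_left)
        show "window (level T x) b \<subseteq> ?W" using that by (auto simp: window_def)
        show "\<forall>z\<in>?W - window (level T x) b. coef T x z * s z = 0"
          using that level_le[of x] by (fastforce simp: window_def)
      qed simp
      finally show ?thesis by (simp add: sum_distrib_left mult.assoc)
    qed
    have zero: "(\<Sum>x\<in>?W. coef T y x * coef T x z) = 0" if "z \<in> ?W" for z
    proof -
      have sub: "{x. x \<in> gens T \<and> coef T y x * coef T x z \<noteq> 0} \<subseteq> ?W"
      proof
        fix x assume "x \<in> {x. x \<in> gens T \<and> coef T y x * coef T x z \<noteq> 0}"
        then have "x \<in> gens T" "coef T y x \<noteq> 0" "coef T x z \<noteq> 0" by auto
        then show "x \<in> ?W"
          using level_le[of y x] level_le[of x z] that y by (auto simp: window_def)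
      qed
      have "(\<Sum>x\<in>?W. coef T y x * coef T x z) =
          (\<Sum>x | x \<in> gens T \<and> coef T y x * coef T x z \<noteq> 0. coef T y x * coef T x z)"
        using sub by (intro sum.mono_neutral_right finite_window) (auto simp: window_def)
      also have "\<dots> = 0"
        using floer y that by (simp add: floer_triple_def window_def)
      finally show ?thesis .
    qed
    have "diff T (diff T s) y = (\<Sum>x\<in>?W. \<Sum>z\<in>?W. coef T y x * coef T x z * s z)"
      using diff_apply[OF diff_closed[OF assms] y] inner by simp
    also have "\<dots> = (\<Sum>z\<in>?W. (\<Sum>x\<in>?W. coef T y x * coef T x z) * s z)"
      by (subst sum.swap) (simp add: sum_distrib_right)
    also have "\<dots> = 0" using zero by simp
    finally show ?thesis by simp
  qed (simp add: diff_off)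
qed

text \<open>\<open>u\<close> and its top part differ by a chain bounded by \<open>b - 1\<close>, and
  \<open>d\<close> is linear. Hence \<open>d u\<close> may be replaced by \<open>d\<close> of the
  top part modulo boundaries one level lower.\<close>

lemma diff_trunc_boundary:
  assumes "u \<in> C b" shows "diff T u - diff T (trunc T b u) \<in> diff T ` C (b - 1)"
proof -
  have "diff T u - diff T (trunc T b u) = diff T (u - trunc T b u)"
    using assms by (intro diff_minus[symmetric, of _ b]) (auto intro: FCwin_le trunc_win)
  then show ?thesis using minus_trunc[OF assms] by blast
qed

text \<open>Truncation is a chain map because \<open>d\<close> preserves the chains bounded by
  \<open>b - 1\<close>, and these are what truncation kills.\<close>

lemma diff_win_trunc:
  assumes "s \<in> C b" shows "diff_win T b (trunc T b s) = trunc T b (diff T s)"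
proof -
  have "diff T s - diff T (trunc T b s) \<in> C (b - 1)" using diff_trunc_boundary[OF assms] by auto
  moreover from this have "diff T s - diff T (trunc T b s) \<in> C b" by (rule FCle_mono[rotated]) simp
  ultimately have "trunc T b (diff T s - diff T (trunc T b s)) = 0"
    by (simp only: trunc_eq_0_iff)
  then show ?thesis by (simp add: diff_win_def trunc_linear)
qed

section \<open>The three complexes, their cycles and homology classes\<close>

sublocale le: chain_module "FCle T b" "diff T" for b
proof -
  have "chain_module_axioms (FCle T b) (diff T)"
    by unfold_locales (auto simp: rmod_hom_def intro: diff_add diff_scale)
  then show "chain_module (FCle T b) (diff T)"
    by (simp add: chain_module_def right_module_FCle)
qed

sublocale tot: chain_module "FC T" "diff T"
proof -
  have "diff T (s + t) = diff T s + diff T t" if "s \<in> C a" "t \<in> C b" for s t a b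
    using that FCle_mono[of a "max a b" s] FCle_mono[of b "max a b" t]
    by (intro diff_add[of _ "max a b"]) auto
  then have "chain_module_axioms (FC T) (diff T)"
    by unfold_locales (auto simp: rmod_hom_def FC_carrier intro: diff_scale)
  then show "chain_module (FC T) (diff T)"
    by (simp add: chain_module_def right_module_FC)
qed

sublocale win: chain_module "FCwin T b b" "diff_win T b" for b
proof -
  have "chain_module_axioms (FCwin T b b) (diff_win T b)"
  proof
    show "diff_win T b \<in> rmod_hom (FCwin T b b) (FCwin T b b)"
      unfolding rmod_hom_def using trunc_win[OF diff_closed[OF FCwin_le]]
      by (auto simp: diff_win_def diff_add[OF FCwin_le FCwin_le] diff_scale[OF FCwin_le]
          trunc_linear)
    fix x assume "x \<in> Cw b"
    then show "diff_win T b (diff_win T b x) = rzero (FCwin T b b)"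
      using diff_win_trunc[of "diff T x" b] FCwin_le[of x T b b]
      by (simp add: diff_win_def trunc_linear)
  qed
  then show "chain_module (FCwin T b b) (diff_win T b)"
    by (simp add: chain_module_def right_module_FCwin)
qed

lemma Z_iff: "s \<in> Z b \<longleftrightarrow> s \<in> C b \<and> diff T s = 0"
  by (simp add: cycles_def)

text \<open>A window cycle is a chain at level \<open>b\<close> whose full differential drops below
  \<open>b\<close>; this differential represents its image under \<open>conn\<close>.\<close>

lemma Zw_iff: "n \<in> Zw b \<longleftrightarrow> n \<in> Cw b \<and> diff T n \<in> C (b - 1)"
  using trunc_eq_0_iff[of "diff T n" T b] FCwin_le[of n T b] by (auto simp: cycles_def diff_win_def)

lemma Ztot_iff: "s \<in> cycles (FC T) (diff T) \<longleftrightarrow> (\<exists>b. s \<in> Z b)"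
  by (auto simp: cycles_def FC_carrier)

lemma Z_mono: "a \<le> b \<Longrightarrow> s \<in> Z a \<Longrightarrow> s \<in> Z b"
  using FCle_mono by (auto simp: Z_iff)

lemma Z_closed [simp, intro]:
  "0 \<in> Z b" "s \<in> Z b \<Longrightarrow> t \<in> Z b \<Longrightarrow> s + t \<in> Z b" "s \<in> Z b \<Longrightarrow> t \<in> Z b \<Longrightarrow> s - t \<in> Z b"
  "s \<in> Z b \<Longrightarrow> (\<lambda>c. s c * r) \<in> Z b" "u \<in> C b \<Longrightarrow> diff T u \<in> Z b"
  using le.cycles_closed[where b = b] le.boundary_cycle[of u b] by simp_all

lemma Z_C: "s \<in> Z b \<Longrightarrow> s \<in> C b"
  by (simp add: Z_iff)

lemma trunc_Zw: "s \<in> Z b \<Longrightarrow> trunc T b s \<in> Zw b"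
  using diff_win_trunc[of s b] by (auto simp: cycles_def trunc_linear intro: trunc_win)

lemma diff_Zw: "n \<in> Zw b \<Longrightarrow> diff T n \<in> Z (b - 1)"
  using FCwin_le by (fastforce simp: Zw_iff Z_iff)

lemma FHle_carrier: "rcarrier (FHle T b) = cls_le T b ` Z b"
  by (simp add: FHle_def le.homology_carrier cls_le_def)
lemmas FHle_zero = le.homology_zero[folded FHle_def, folded cls_le_def, simplified]
lemmas FHle_add = le.homology_add[folded FHle_def, folded cls_le_def, simplified]
lemmas FHle_scale = le.homology_scale[folded FHle_def, folded cls_le_def, simplified]
lemmas cls_le_eq_iff = le.hclass_eq_iff[folded cls_le_def, simplified]
lemmas UN_cls_le = le.UN_hclass[folded cls_le_def]

lemma FHwin_carrier: "rcarrier (FHwin T b b) = cls_win T b b ` Zw b"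
  by (simp add: FHwin_def win.homology_carrier cls_win_def)
lemmas FHwin_zero = win.homology_zero[folded FHwin_def, folded cls_win_def, simplified]
lemmas FHwin_add = win.homology_add[folded FHwin_def, folded cls_win_def, simplified]
lemmas FHwin_scale = win.homology_scale[folded FHwin_def, folded cls_win_def, simplified]
lemmas cls_win_eq_iff = win.hclass_eq_iff[folded cls_win_def, simplified]
lemmas UN_cls_win = win.UN_hclass[folded cls_win_def]

lemma FH_carrier: "rcarrier (FH T) = cls T ` cycles (FC T) (diff T)"
  by (simp add: FH_def tot.homology_carrier cls_def)
lemmas FH_zero = tot.homology_zero[folded FH_def, folded cls_def, simplified]
lemmas FH_add = tot.homology_add[folded FH_def, folded cls_def, simplified]
lemmas FH_scale = tot.homology_scale[folded FH_def, folded cls_def, simplified]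
lemmas cls_eq_iff = tot.hclass_eq_iff[folded cls_def, simplified]

sublocale FHle: right_module "FHle T b" for b
  using le.right_module_homology by (simp add: FHle_def)

sublocale FHwin: right_module "FHwin T b b" for b
  using win.right_module_homology by (simp add: FHwin_def)

sublocale FH: right_module "FH T"
  using tot.right_module_homology by (simp add: FH_def)

lemma cls_le_closed [simp, intro]: "s \<in> Z b \<Longrightarrow> cls_le T b s \<in> rcarrier (FHle T b)"
  by (simp add: FHle_carrier)

lemma FHle_cases:
  assumes "X \<in> rcarrier (FHle T b)" obtains s where "s \<in> Z b" "X = cls_le T b s"
  using assms by (auto simp: FHle_carrier)

lemma FHwin_cases:
  assumes "X \<in> rcarrier (FHwin T b b)" obtains n where "n \<in> Zw b" "X = cls_win T b b n"
  using assms by (auto simp: FHwin_carrier)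

lemma cls_le_eq_0_iff: "s \<in> Z b \<Longrightarrow> cls_le T b s = rzero (FHle T b) \<longleftrightarrow> s \<in> diff T ` C b"
  by (simp add: FHle_zero cls_le_eq_iff)

lemma cls_win_eq_0_iff:
  "n \<in> Zw b \<Longrightarrow> cls_win T b b n = rzero (FHwin T b b) \<longleftrightarrow> n \<in> diff_win T b ` Cw b"
  using win.cycles_closed(1)[of b] by (simp add: FHwin_zero cls_win_eq_iff)

text \<open>In \<open>FH\<close> the bounding chain may reach a level \<open>a\<close> above
  \<open>b\<close>, since a chain of the total complex has some upper bound.\<close>

lemma cls_eq_0_iff: "s \<in> Z b \<Longrightarrow> cls T s = rzero (FH T) \<longleftrightarrow> (\<exists>a. s \<in> diff T ` C a)"
proof -
  assume "s \<in> Z b"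
  then have "s \<in> cycles (FC T) (diff T)" "0 \<in> cycles (FC T) (diff T)"
    using Ztot_iff Z_closed(1) by blast+
  then show ?thesis by (auto simp: FH_zero cls_eq_iff FC_carrier)
qed

section \<open>The exact sequences\<close>

lemma boundary_mono: "a \<le> b \<Longrightarrow> s \<in> diff T ` C a \<Longrightarrow> s \<in> diff T ` C b"
  using FCle_mono by blast

lemma iota_cls:
  assumes "s \<in> Z (b - 1)" shows "iota T b (cls_le T (b - 1) s) = cls_le T b s"
  unfolding iota_def
proof (rule UN_cls_le[OF assms])
  fix t assume "t \<in> Z (b - 1)" "cls_le T (b - 1) t = cls_le T (b - 1) s"
  then show "cls_le T b t = cls_le T b s"
    using assms Z_mono[of "b - 1" b] boundary_mono[of "b - 1" b] by (simp add: cls_le_eq_iff)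
qed

lemma iota_lim_cls:
  assumes "s \<in> Z b" shows "iota_lim T (cls_le T b s) = cls T s"
  unfolding iota_lim_def
proof (rule UN_cls_le[OF assms])
  fix t assume t: "t \<in> Z b" "cls_le T b t = cls_le T b s"
  moreover have "t \<in> cycles (FC T) (diff T)" "s \<in> cycles (FC T) (diff T)"
    using t assms Ztot_iff by blast+
  ultimately show "cls T t = cls T s"
    using assms FC_le by (auto simp: cls_le_eq_iff cls_eq_iff)
qed

text \<open>Independence of the representative holds because truncation is a chain map.\<close>

lemma proj_cls:
  assumes "s \<in> Z b" shows "proj T b (cls_le T b s) = cls_win T b b (trunc T b s)"
  unfolding proj_def
proof (rule UN_cls_le[OF assms])
  fix t assume t: "t \<in> Z b" "cls_le T b t = cls_le T b s"
  then obtain u where u: "u \<in> C b" "t - s = diff T u" using assms by (auto simp: cls_le_eq_iff)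
  then have "trunc T b t - trunc T b s = diff_win T b (trunc T b u)"
    by (simp add: diff_win_trunc flip: trunc_linear)
  then show "cls_win T b b (trunc T b t) = cls_win T b b (trunc T b s)"
    using t assms trunc_Zw trunc_win[OF u(1)] by (auto simp: cls_win_eq_iff)
qed

text \<open>Since \<open>d (d u) = 0\<close>, replacing \<open>d u\<close> by its top part leaves
  only a boundary from below. This makes \<open>conn\<close> independent of the
  representative.\<close>

lemma diff_diff_win:
  assumes "u \<in> C b" shows "diff T (diff_win T b u) \<in> diff T ` C (b - 1)"
proof -
  have "diff T (diff T u) - diff T (diff_win T b u) \<in> diff T ` C (b - 1)"
    unfolding diff_win_def using assms by (intro diff_trunc_boundary) simp
  then obtain v where v: "v \<in> C (b - 1)" "- diff T (diff_win T b u) = diff T v"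
    using assms by auto
  then have "diff T (diff_win T b u) = diff T (0 - v)"
    using diff_minus[of 0 "b - 1" v] by (simp add: neg_eq_iff_add_eq_0 flip: v(2))
  then show ?thesis using v FCle_closed(1,3) by blast
qed

lemma conn_cls:
  assumes "n \<in> Zw b" shows "conn T b (cls_win T b b n) = cls_le T (b - 1) (diff T n)"
  unfolding conn_def
proof (rule UN_cls_win[OF assms])
  fix m assume m: "m \<in> Zw b" "cls_win T b b m = cls_win T b b n"
  then obtain u where u: "u \<in> Cw b" "m - n = diff_win T b u"
    using assms by (auto simp: cls_win_eq_iff)
  have "diff T m - diff T n = diff T (m - n)"
    using m assms by (intro diff_minus[symmetric, of _ b]) (auto simp: Zw_iff intro: FCwin_le)
  then have "diff T m - diff T n \<in> diff T ` C (b - 1)"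
    using u diff_diff_win[OF FCwin_le] by simp
  then show "cls_le T (b - 1) (diff T m) = cls_le T (b - 1) (diff T n)"
    using m assms diff_Zw by (simp add: cls_le_eq_iff)
qed

lemma iota_hom: "iota T b \<in> rmod_hom (FHle T (b - 1)) (FHle T b)"
  unfolding rmod_hom_def
  by (auto elim!: FHle_cases simp: iota_cls FHle_add FHle_scale Z_mono[of "b - 1" b])

lemma proj_hom: "proj T b \<in> rmod_hom (FHle T b) (FHwin T b b)"
  unfolding rmod_hom_def
  by (auto elim!: FHle_cases simp: proj_cls FHle_add FHle_scale FHwin_add FHwin_scale
      FHwin_carrier trunc_Zw trunc_linear)

lemma conn_hom: "conn T b \<in> rmod_hom (FHwin T b b) (FHle T (b - 1))"
proof -
  have lin: "diff T (n + m) = diff T n + diff T m" "diff T (\<lambda>c. n c * r) = (\<lambda>c. diff T n c * r)"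
    if "n \<in> Zw b" "m \<in> Zw b" for n m r
    using that by (auto simp: Zw_iff intro!: diff_add[of _ b] diff_scale[of _ b] FCwin_le)
  show ?thesis
    unfolding rmod_hom_def
    using win.cycles_closed(2,3)[of _ b]
    by (auto elim!: FHwin_cases simp: conn_cls FHwin_add FHwin_scale FHle_add FHle_scale
        diff_Zw lin)
qed

text \<open>Exactness at \<open>FHwin T b b\<close>. For a cycle, \<open>d\<close> of its top part
  is minus \<open>d\<close> of the rest; conversely a window cycle with \<open>d n = d u\<close> and
  \<open>u\<close> of lower level is the top part of the cycle \<open>n - u\<close>.\<close>

lemma proj_image: "proj T b ` rcarrier (FHle T b) = rcarrier (aleph_at T b)"
proof (intro equalityI subsetI)
  fix X assume "X \<in> proj T b ` rcarrier (FHle T b)"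
  then obtain s where s: "s \<in> Z b" "X = cls_win T b b (trunc T b s)"
    by (auto elim!: FHle_cases simp: proj_cls)
  \<comment> \<open>The \<open>0\<close> is \<open>d s\<close>.\<close>
  have "0 - diff T (trunc T b s) \<in> diff T ` C (b - 1)"
    using diff_trunc_boundary[of s b] s(1) by (simp add: Z_iff)
  then have "cls_le T (b - 1) 0 = cls_le T (b - 1) (diff T (trunc T b s))"
    using cls_le_eq_iff[of 0 "b - 1"] diff_Zw[OF trunc_Zw] s(1) by simp
  then show "X \<in> rcarrier (aleph_at T b)"
    using s by (simp add: aleph_at_def conn_cls trunc_Zw FHle_zero FHwin_carrier)
next
  fix X assume "X \<in> rcarrier (aleph_at T b)"
  then obtain n where n: "n \<in> Zw b" "X = cls_win T b b n"
    and "cls_le T (b - 1) (diff T n) = rzero (FHle T (b - 1))"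
    by (auto simp: aleph_at_def conn_cls elim!: FHwin_cases)
  then obtain u where u: "u \<in> C (b - 1)" "diff T n = diff T u"
    using diff_Zw by (auto simp: cls_le_eq_0_iff)
  have ub: "u \<in> C b" using u FCle_mono[of "b - 1" b] by auto
  have nb: "n \<in> Cw b" "n \<in> C b" using n FCwin_le by (auto simp: Zw_iff)
  have "n - u \<in> Z b" using ub nb u(2) diff_minus[of n b u] by (simp add: Z_iff)
  moreover have "trunc T b (n - u) = n"
    using nb trunc_id trunc_eq_0_iff[OF ub] u(1) by (simp add: trunc_linear)
  ultimately show "X \<in> proj T b ` rcarrier (FHle T b)"
    using n(2) proj_cls[of "n - u" b] by (metis cls_le_closed imageI)
qed

text \<open>The inclusion needed for exactness at \<open>FHle T b\<close>: if the top part of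
  \<open>s\<close> is the top part of \<open>d u\<close>, then \<open>s - d u\<close> is a
  homologous cycle bounded by \<open>b - 1\<close>.\<close>

lemma iota_image_iff:
  assumes "X \<in> rcarrier (FHle T b)" "proj T b X = rzero (FHwin T b b)"
  shows "X \<in> rcarrier (im_iota T b)"
proof -
  obtain s where s: "s \<in> Z b" "X = cls_le T b s" using assms(1) FHle_cases by blast
  then obtain u where u: "u \<in> Cw b" "trunc T b s = diff_win T b u"
    using assms(2) by (auto simp: proj_cls cls_win_eq_0_iff trunc_Zw)
  have ub: "u \<in> C b" using u FCwin_le by blast
  have "s - diff T u \<in> Z b" using s ub by blast
  moreover have "s - diff T u \<in> C (b - 1)"
    using u ub s trunc_eq_0_iff[of "s - diff T u" T b]
    by (simp add: trunc_linear diff_win_def Z_iff)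
  ultimately have z: "s - diff T u \<in> Z (b - 1)" by (simp add: Z_iff)
  moreover have "X = cls_le T b (s - diff T u)"
    using s ub \<open>s - diff T u \<in> Z b\<close> by (simp add: cls_le_eq_iff)
  ultimately have "X = iota T b (cls_le T (b - 1) (s - diff T u))" by (simp add: iota_cls)
  then show ?thesis using z by (simp add: im_iota_def)
qed

text \<open>Exactness at \<open>FHle T (b - 1)\<close>. If a cycle \<open>s\<close> from below
  equals \<open>d u\<close>, then the top part of \<open>u\<close> is a window cycle and
  \<open>conn\<close> sends its class to that of \<open>s\<close>.\<close>

lemma K_at_carrier:
  "rcarrier (K_at T (b - 1)) =
    {X \<in> rcarrier (FHle T (b - 1)). iota T b X = rzero (FHle T b)}"
proof (intro equalityI subsetI)
  fix X assume "X \<in> rcarrier (K_at T (b - 1))"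
  then obtain n where n: "n \<in> Zw b" "X = cls_le T (b - 1) (diff T n)"
    by (auto simp: K_at_def conn_cls elim!: FHwin_cases)
  have "n \<in> C b" using n(1) FCwin_le by (auto simp: Zw_iff)
  then have "diff T n \<in> diff T ` C b" "diff T n \<in> Z b" by auto
  then show "X \<in> {X \<in> rcarrier (FHle T (b - 1)). iota T b X = rzero (FHle T b)}"
    using n diff_Zw by (simp add: iota_cls cls_le_eq_0_iff)
next
  fix X assume "X \<in> {X \<in> rcarrier (FHle T (b - 1)). iota T b X = rzero (FHle T b)}"
  then obtain s where s: "s \<in> Z (b - 1)" "X = cls_le T (b - 1) s"
    and "cls_le T b s = rzero (FHle T b)"
    by (auto elim!: FHle_cases simp: iota_cls)
  then obtain u where u: "u \<in> C b" "s = diff T u"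
    using Z_mono[of "b - 1" b] by (auto simp: cls_le_eq_0_iff)
  \<comment> \<open>Hence \<open>d u\<close> has no part at level \<open>b\<close>, which makes the
    top part of \<open>u\<close> a window cycle.\<close>
  have "trunc T b s = 0"
    using s(1) trunc_eq_0_iff[of s T b] FCle_mono[of "b - 1" b s] by (simp add: Z_iff)
  then have n: "trunc T b u \<in> Zw b"
    using u diff_win_trunc[of u b] trunc_win by (simp add: cycles_def)
  have "X = conn T b (cls_win T b b (trunc T b u))"
    using s n u diff_trunc_boundary[of u b] diff_Zw by (simp add: conn_cls cls_le_eq_iff)
  then show "X \<in> rcarrier (K_at T (b - 1))"
    using n by (simp add: K_at_def FHwin_carrier)
qed

section \<open>Infinite sums\<close>

lemma series_closed:
  assumes "\<And>b. b \<le> b0 \<Longrightarrow> s b \<in> C b" shows "series T b0 s \<in> C b0"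
  unfolding FCle_iff
proof (intro allI impI)
  fix c assume nz: "series T b0 s c \<noteq> 0"
  then obtain b where "b \<in> {level T c..b0}" "s b c \<noteq> 0"
    unfolding series_def by (meson sum.not_neutral_contains_not_neutral)
  then show "c \<in> gens T \<and> level T c \<le> b0" using assms[of b] by (auto simp: FCle_iff)
qed

text \<open>At a fixed generator \<open>y\<close> only indices from the level of \<open>y\<close> to
  \<open>b0\<close> and generators in one window matter, so \<open>d\<close> passes through the
  infinite sum by exchanging finite sums.\<close>

lemma diff_series:
  assumes u: "\<And>b. b \<le> b0 \<Longrightarrow> u b \<in> C b"
  shows "diff T (series T b0 u) = series T b0 (\<lambda>b. diff T (u b))"
proof
  fix y show "diff T (series T b0 u) y = series T b0 (\<lambda>b. diff T (u b)) y"
  proof (cases "y \<in> gens T")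
    case y: True
    let ?W = "window (level T y) b0"
    \<comment> \<open>The lower limit is made independent of \<open>x\<close>; the added terms
      vanish because \<open>u b\<close> is bounded by \<open>b\<close>.\<close>
    have "series T b0 u x = (\<Sum>b\<in>{level T y..b0}. u b x)" if "x \<in> ?W" for x
      unfolding series_def
    proof (rule sum.mono_neutral_left)
      show "\<forall>b\<in>{level T y..b0} - {level T x..b0}. u b x = 0"
        using u by (force simp: FCle_iff)
    qed (use that in \<open>auto simp: window_def\<close>)
    then have "diff T (series T b0 u) y = (\<Sum>x\<in>?W. \<Sum>b\<in>{level T y..b0}. coef T y x * u b x)"
      using diff_apply[OF series_closed[OF u] y] by (simp add: sum_distrib_left)
    also have "\<dots> = (\<Sum>b\<in>{level T y..b0}. \<Sum>x\<in>?W. coef T y x * u b x)"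
      by (rule sum.swap)
    also have "\<dots> = (\<Sum>b\<in>{level T y..b0}. diff T (u b) y)"
      using u y by (intro sum.cong refl diff_apply[symmetric]) (auto intro: FCle_mono)
    finally show ?thesis by (simp add: series_def)
  qed (simp add: diff_off series_def)
qed

lemma series_cycle:
  assumes "\<And>b. b \<le> b0 \<Longrightarrow> s b \<in> Z b" shows "series T b0 s \<in> Z b0"
  using diff_series[of b0 s] series_closed[of b0 s] assms
  by (simp add: Z_iff) (simp add: series_def fun_eq_iff)

lemma series_step:
  assumes "s b0 \<in> C b0" shows "series T b0 s = s b0 + series T (b0 - 1) s"
proof
  fix c show "series T b0 s c = (s b0 + series T (b0 - 1) s) c"
  proof (cases "level T c \<le> b0")
    case True
    then have "{level T c..b0} = insert b0 {level T c..b0 - 1}" by auto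
    then show ?thesis by (simp add: series_def)
  qed (use assms in \<open>auto simp: series_def FCle_iff\<close>)
qed

text \<open>Padding with zeros changes the upper limit without changing the sum; it serves to
  compare sums with different limits.\<close>

lemma series_extend:
  assumes "b0 \<le> b1"
  shows "series T b1 (\<lambda>b. if b \<le> b0 then s b else 0) = series T b0 s"
proof
  fix c
  have "(\<Sum>b\<in>{level T c..b1}. (if b \<le> b0 then s b else 0) c) = (\<Sum>b\<in>{level T c..b0}. s b c)"
    using assms by (intro sum.mono_neutral_cong_right) auto
  then show "series T b1 (\<lambda>b. if b \<le> b0 then s b else 0) c = series T b0 s c"
    by (simp add: series_def)
qed

text \<open>Chains \<open>u b\<close> bounding the successive differences are summed to one infinite
  chain; its differential telescopes in each coefficient. This is where completeness of
  \<open>FC\<close> enters.\<close>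

lemma telescope:
  assumes s: "\<And>b. b \<le> b0 \<Longrightarrow> s b \<in> C b" and t: "\<And>b. b \<le> b0 \<Longrightarrow> t b \<in> C b"
    and bd: "\<And>b. b \<le> b0 \<Longrightarrow> t b - s b - t (b - 1) \<in> diff T ` C b"
  shows "t b0 - series T b0 s \<in> diff T ` C b0"
proof -
  have "\<forall>b. \<exists>u. b \<le> b0 \<longrightarrow> u \<in> C b \<and> diff T u = t b - s b - t (b - 1)" using bd by force
  then obtain u where u: "\<And>b. b \<le> b0 \<Longrightarrow> u b \<in> C b"
    and du: "\<And>b. b \<le> b0 \<Longrightarrow> diff T (u b) = t b - s b - t (b - 1)" by metis
  have "series T b0 (\<lambda>b. diff T (u b)) = t b0 - series T b0 s"
  proof
    fix c
    \<comment> \<open>Allowing \<open>b1 = a - 1\<close> includes the empty sum, which starts the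
      induction.\<close>
    have tel: "(\<Sum>b\<in>{a..b1}. t b c - t (b - 1) c) = t b1 c - t (a - 1) c"
      if "a - 1 \<le> b1" for a b1 using that
    proof (induction b1 rule: int_ge_induct)
      case (step i)
      have "{a..i + 1} = insert (i + 1) {a..i}" using step.hyps by auto
      then show ?case using step.IH by simp
    qed simp
    show "series T b0 (\<lambda>b. diff T (u b)) c = (t b0 - series T b0 s) c"
    proof (cases "level T c \<le> b0")
      case True
      \<comment> \<open>The telescoping sum has no contribution from its lower end, since
        \<open>t b\<close> has no coefficients above level \<open>b\<close>.\<close>
      have "t (level T c - 1) c = 0" using t[of "level T c - 1"] True by (force simp: FCle_iff)
      then have "(\<Sum>b\<in>{level T c..b0}. t b c - t (b - 1) c) = t b0 c"
        using tel[of "level T c" b0] True by simp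
      moreover have "(\<Sum>b\<in>{level T c..b0}. diff T (u b) c) =
          (\<Sum>b\<in>{level T c..b0}. t b c - t (b - 1) c) - (\<Sum>b\<in>{level T c..b0}. s b c)"
        unfolding sum_subtractf[symmetric] using du by (intro sum.cong) auto
      ultimately show ?thesis by (simp add: series_def)
    next
      case False
      then show ?thesis using t[of b0] by (auto simp: series_def FCle_iff)
    qed
  qed
  then show ?thesis using diff_series[OF u] series_closed[OF u] by (metis imageI)
qed

text \<open>Completeness of the filtration: a class is recovered from its successive remainders.\<close>

lemma cls_series:
  assumes s: "\<And>b. b \<le> b0 \<Longrightarrow> s b \<in> Z b"
    and \<sigma>: "\<And>b. b \<le> b0 \<Longrightarrow> \<sigma> b \<in> rcarrier (FHle T b)"
    and step: "\<And>b. b \<le> b0 \<Longrightarrow>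
      \<sigma> b = radd (FHle T b) (cls_le T b (s b)) (iota T b (\<sigma> (b - 1)))"
  shows "\<sigma> b0 = cls_le T b0 (series T b0 s)"
proof -
  have "\<forall>b. \<exists>t. b \<le> b0 \<longrightarrow> t \<in> Z b \<and> \<sigma> b = cls_le T b t" using \<sigma> FHle_cases by metis
  then obtain t where t: "\<And>b. b \<le> b0 \<Longrightarrow> t b \<in> Z b"
    and st: "\<And>b. b \<le> b0 \<Longrightarrow> \<sigma> b = cls_le T b (t b)" by metis
  have "t b - s b - t (b - 1) \<in> diff T ` C b" if "b \<le> b0" for b
  proof -
    have t1: "t (b - 1) \<in> Z (b - 1)" "\<sigma> (b - 1) = cls_le T (b - 1) (t (b - 1))"
      using t[of "b - 1"] st[of "b - 1"] that by auto
    have "cls_le T b (t b) = cls_le T b (s b + t (b - 1))"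
      using step[OF that] st[OF that] t1 s[OF that] Z_mono[of "b - 1" b]
      by (simp add: iota_cls FHle_add)
    moreover have "s b + t (b - 1) \<in> Z b" using s[OF that] t1 Z_mono[of "b - 1" b] by simp
    ultimately show ?thesis
      using t[OF that] by (simp add: cls_le_eq_iff diff_diff_eq)
  qed
  then have "t b0 - series T b0 s \<in> diff T ` C b0"
    using s t by (intro telescope) (auto simp: Z_iff)
  then show ?thesis
    using st[of b0] t[of b0] series_cycle[of b0 s] s by (simp add: cls_le_eq_iff)
qed

section \<open>The maps \<open>\<Phi>\<close> and \<open>\<Psi>\<close>\<close>

lemma sub_simps [simp]:
  "radd (aleph_at T b) = radd (FHwin T b b)" "rzero (aleph_at T b) = rzero (FHwin T b b)"
  "rscale (aleph_at T b) = rscale (FHwin T b b)"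
  "radd (K_at T b) = radd (FHle T b)" "rzero (K_at T b) = rzero (FHle T b)"
  "rscale (K_at T b) = rscale (FHle T b)"
  "radd (im_iota T b) = radd (FHle T b)" "rzero (im_iota T b) = rzero (FHle T b)"
  "rscale (im_iota T b) = rscale (FHle T b)"
  by (simp_all add: aleph_at_def K_at_def im_iota_def)

lemma right_module_aleph_at: "right_module (aleph_at T b)"
  unfolding aleph_at_def
  by (intro FHwin.right_module_sub rsubmodule_kernel[OF _ _ conn_hom]) unfold_locales

lemma right_module_K_at: "right_module (K_at T b)"
proof -
  have "conn T (b + 1) \<in> rmod_hom (FHwin T (b + 1) (b + 1)) (FHle T b)"
    using conn_hom[of "b + 1"] by simp
  then show ?thesis
    unfolding K_at_def
    by (intro FHle.right_module_sub rsubmodule_image) unfold_locales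
qed

lemma aleph_at_carrier_win: "X \<in> rcarrier (aleph_at T b) \<Longrightarrow> X \<in> rcarrier (FHwin T b b)"
  by (simp add: aleph_at_def)

lemma K_at_carrier_le: "X \<in> rcarrier (K_at T b) \<Longrightarrow> X \<in> rcarrier (FHle T b)"
  using K_at_carrier[of "b + 1"] by simp

text \<open>The section theorem is applied to \<open>proj\<close> and to \<open>iota\<close>; by
  exactness the image of \<open>proj\<close> is the domain required of
  \<open>\<rho>\<close>.\<close>

lemma linear_sections_exist:
  assumes "semisimple_ring TYPE('r)" shows "\<exists>\<rho> j. linear_sections T \<rho> j"
proof -
  have "\<forall>b. \<exists>k. k \<in> rmod_hom (aleph_at T b) (FHle T b) \<and>
      (\<forall>X\<in>rcarrier (aleph_at T b). proj T b (k X) = X)"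
    using FHle.linear_section_exists[OF assms FHwin.right_module_axioms proj_hom]
    unfolding proj_image by (metis (no_types, lifting) aleph_at_def rmod.surjective rmod.update_convs(1) rmod.select_convs(1))
  moreover have "\<forall>b. \<exists>k. k \<in> rmod_hom (im_iota T b) (FHle T (b - 1)) \<and>
      (\<forall>Y\<in>rcarrier (im_iota T b). iota T b (k Y) = Y)"
    using FHle.linear_section_exists[OF assms FHle.right_module_axioms iota_hom]
    unfolding im_iota_def by (metis (no_types, lifting) rmod.surjective rmod.update_convs(1) rmod.select_convs(1))
  ultimately show ?thesis unfolding linear_sections_def by metis
qed

lemma series_plus: "series T b0 (\<lambda>b. s b + t b) = series T b0 s + series T b0 t"
  by (simp add: series_def fun_eq_iff sum.distrib)

lemma series_scale: "series T b0 (\<lambda>b c. s b c * r) = (\<lambda>c. series T b0 s c * r)"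
  by (simp add: series_def fun_eq_iff sum_distrib_right)

end

section \<open>The recursion for fixed linear sections\<close>

locale floer_sections = floer +
  fixes \<rho> j
  assumes sections: "linear_sections T \<rho> j"
begin

lemma rho_hom: "\<rho> b \<in> rmod_hom (aleph_at T b) (FHle T b)"
  and proj_rho: "X \<in> rcarrier (aleph_at T b) \<Longrightarrow> proj T b (\<rho> b X) = X"
  and j_hom: "j b \<in> rmod_hom (im_iota T b) (FHle T (b - 1))"
  and iota_j: "Y \<in> rcarrier (im_iota T b) \<Longrightarrow> iota T b (j b Y) = Y"
  using sections by (auto simp: linear_sections_def)

lemma rho_closed: "X \<in> rcarrier (aleph_at T b) \<Longrightarrow> \<rho> b X \<in> rcarrier (FHle T b)"
  using rmod_hom_closed[OF rho_hom] .

lemma rho_0: "\<rho> b (rzero (FHwin T b b)) = rzero (FHle T b)"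
  using rmod_hom_zero[OF right_module_aleph_at FHle.right_module_axioms rho_hom] by simp

lemma proj_0: "proj T b (rzero (FHle T b)) = rzero (FHwin T b b)"
  using rmod_hom_zero[OF FHle.right_module_axioms FHwin.right_module_axioms proj_hom] .

lemma proj_aleph: "X \<in> rcarrier (FHle T b) \<Longrightarrow> proj T b X \<in> rcarrier (aleph_at T b)"
  using proj_image by blast

text \<open>The part of the step from \<open>\<sigma> b\<close> to \<open>\<sigma> (b - 1)\<close>
  that does not involve \<open>\<kappa>\<close>: the leading part is split off and the rest is
  lifted by \<open>j\<close>.\<close>

definition remainder where
  "remainder b X = j b (rminus (FHle T b) X (\<rho> b (proj T b X)))"

text \<open>\<open>proj\<close> kills this difference because \<open>\<rho>\<close> is a section of
  it, and exactness then puts the difference into the domain of \<open>j\<close>.\<close>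

lemma remainder_im:
  assumes "X \<in> rcarrier (FHle T b)"
  shows "rminus (FHle T b) X (\<rho> b (proj T b X)) \<in> rcarrier (im_iota T b)"
proof (rule iota_image_iff)
  note [simp] = rho_closed proj_aleph assms
  show "rminus (FHle T b) X (\<rho> b (proj T b X)) \<in> rcarrier (FHle T b)" by simp
  show "proj T b (rminus (FHle T b) X (\<rho> b (proj T b X))) = rzero (FHwin T b b)"
    by (simp add: rmod_hom_minus[OF FHle.right_module_axioms proj_hom] proj_rho
        aleph_at_carrier_win)
qed

text \<open>Linearity of both sections makes each step of the recursion linear.\<close>

lemma remainder_hom: "remainder b \<in> rmod_hom (FHle T b) (FHle T (b - 1))"
proof -
  have p: "proj T b \<in> rmod_hom (FHle T b) (aleph_at T b)"
    using proj_hom[of b] proj_aleph by (auto simp: rmod_hom_def)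
  have "(\<lambda>X. rminus (FHle T b) X ((\<rho> b \<circ> proj T b) X)) \<in> rmod_hom (FHle T b) (FHle T b)"
    by (intro rmod_hom_diff rmod_hom_comp[OF p rho_hom]) (unfold_locales, simp add: rmod_hom_def)
  then have "(\<lambda>X. rminus (FHle T b) X (\<rho> b (proj T b X))) \<in> rmod_hom (FHle T b) (im_iota T b)"
    using remainder_im by (simp add: rmod_hom_def)
  from rmod_hom_comp[OF this j_hom] show ?thesis
    by (simp add: remainder_def[abs_def] comp_def)
qed

lemma iota_remainder:
  "X \<in> rcarrier (FHle T b) \<Longrightarrow>
    iota T b (remainder b X) = rminus (FHle T b) X (\<rho> b (proj T b X))"
  by (simp add: remainder_def iota_j remainder_im)

lemma remainder_0: "remainder b (rzero (FHle T b)) = rzero (FHle T (b - 1))"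
  using rmod_hom_zero[OF FHle.right_module_axioms FHle.right_module_axioms remainder_hom] .

lemmas remainder_closed = rmod_hom_closed[OF remainder_hom]

text \<open>The recursion defining \<open>\<Phi>\<close>, with \<open>\<sigma>\<close> extended by zero above the top index.  It is stated
  for all \<open>\<kappa>\<close> and not only for those in \<open>K\<close>: started at the class of a cycle, it also produces a
  preimage of that class under \<open>\<Psi>\<close>.\<close>

definition recursion where
  "recursion \<kappa> \<sigma> \<longleftrightarrow> (\<forall>b. \<sigma> b \<in> rcarrier (FHle T b)) \<and>
    (\<forall>b. \<kappa> b \<in> rcarrier (FHle T b)) \<and>
    (\<exists>b0. \<forall>b>b0. \<sigma> b = rzero (FHle T b) \<and> \<kappa> b = rzero (FHle T b)) \<and>
    (\<forall>b. \<sigma> (b - 1) = radd (FHle T (b - 1)) (remainder b (\<sigma> b)) (\<kappa> (b - 1)))"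

lemma recursion_closed:
  assumes "recursion \<kappa> \<sigma>"
  shows "\<sigma> b \<in> rcarrier (FHle T b)" "\<kappa> b \<in> rcarrier (FHle T b)"
  using assms by (simp_all add: recursion_def)

lemma recursion_step:
  "recursion \<kappa> \<sigma> \<Longrightarrow> \<sigma> (b - 1) = radd (FHle T (b - 1)) (remainder b (\<sigma> b)) (\<kappa> (b - 1))"
  by (simp add: recursion_def)

text \<open>Both solutions vanish above a common index, and each value determines the next one
  below.\<close>

lemma recursion_unique:
  assumes "recursion \<kappa> \<sigma>" "recursion \<kappa> \<sigma>'" shows "\<sigma> = \<sigma>'"
proof
  fix b
  obtain p q where pq: "\<forall>b>p. \<sigma> b = rzero (FHle T b)" "\<forall>b>q. \<sigma>' b = rzero (FHle T b)"
    using assms unfolding recursion_def by meson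
  have up: "\<sigma> b = \<sigma>' b" if "b \<ge> max p q + 1" for b using pq that by simp
  have down: "\<sigma> b = \<sigma>' b" if "b \<le> max p q + 1" for b using that
  proof (induction b rule: int_le_induct)
    case (step i)
    then show ?case using assms[THEN recursion_step, of i] by simp
  qed (simp add: up)
  show "\<sigma> b = \<sigma>' b" using up down by (cases "b \<le> max p q + 1") auto
qed

lemma recursion_exists:
  assumes \<kappa>: "\<And>b. \<kappa> b \<in> rcarrier (FHle T b)" and top: "\<And>b. b > b0 \<Longrightarrow> \<kappa> b = rzero (FHle T b)"
  shows "\<exists>\<sigma>. recursion \<kappa> \<sigma> \<and> (\<forall>b>b0. \<sigma> b = rzero (FHle T b))"
proof -
  \<comment> \<open>\<open>F n\<close> computes the value at \<open>b0 - n\<close> from the value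
    one index higher, and \<open>\<tau> n\<close> will be the value of \<open>\<sigma>\<close> at
    \<open>b0 - n\<close>.\<close>
  define F where "F n X = radd (FHle T (b0 - int n)) (remainder (b0 - int n + 1) X)
    (\<kappa> (b0 - int n))" for n X
  define \<tau> where "\<tau> = rec_nat (\<kappa> b0) (\<lambda>n X. F (Suc n) X)"
  have \<tau>: "\<tau> 0 = \<kappa> b0" "\<tau> (Suc n) = F (Suc n) (\<tau> n)" for n by (simp_all add: \<tau>_def)
  define \<sigma> where "\<sigma> b = (if b > b0 then rzero (FHle T b) else \<tau> (nat (b0 - b)))" for b
  have \<sigma>_step: "\<sigma> (b - 1) = radd (FHle T (b - 1)) (remainder b (\<sigma> b)) (\<kappa> (b - 1))" for b
  proof -
    consider "b > b0 + 1" | "b = b0 + 1" | "b \<le> b0" by linarith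
    then show ?thesis
    proof cases
      case 1 then show ?thesis using top[of "b - 1"] by (simp add: \<sigma>_def remainder_0)
    next
      case 2 then show ?thesis
        using \<kappa>[of b0] remainder_0[of "b0 + 1"] by (simp add: \<sigma>_def \<tau>(1))
    next
      case 3
      then have "nat (b0 - (b - 1)) = Suc (nat (b0 - b))" by simp
      then show ?thesis using 3 by (simp add: \<sigma>_def \<tau>(2) F_def algebra_simps)
    qed
  qed
  have closed: "\<sigma> b \<in> rcarrier (FHle T b)" for b
  proof (cases "b \<le> b0 + 1")
    case True
    then show ?thesis
    proof (induction b rule: int_le_induct)
      case (step i)
      then show ?case using \<sigma>_step[of i] \<kappa> remainder_closed by simp
    qed (simp add: \<sigma>_def)
  qed (simp add: \<sigma>_def)
  have "recursion \<kappa> \<sigma>"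
    unfolding recursion_def
    using \<sigma>_step closed top \<kappa> by (auto simp: \<sigma>_def intro!: exI[of _ b0])
  then show ?thesis by (auto simp: \<sigma>_def)
qed

text \<open>Applying \<open>iota\<close> to the recursion removes \<open>\<kappa>\<close> and undoes
  \<open>j\<close>; solving for \<open>\<sigma> b\<close> gives the claim. The kernel condition
  concerns a single index, so a recursion started at an arbitrary class is covered below its
  start.\<close>

lemma recursion_iota:
  assumes rec: "recursion \<kappa> \<sigma>"
    and ker: "iota T b (\<kappa> (b - 1)) = rzero (FHle T b)"
  shows "\<sigma> b = radd (FHle T b) (\<rho> b (proj T b (\<sigma> b))) (iota T b (\<sigma> (b - 1)))"
proof -
  note \<sigma> = recursion_closed(1)[OF rec, of b] and \<kappa> = recursion_closed(2)[OF rec, of "b - 1"]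
  have \<rho>: "\<rho> b (proj T b (\<sigma> b)) \<in> rcarrier (FHle T b)"
    using rho_closed proj_aleph \<sigma> by blast
  have "iota T b (\<sigma> (b - 1)) = rminus (FHle T b) (\<sigma> b) (\<rho> b (proj T b (\<sigma> b)))"
    using recursion_step[OF rec, of b] rmod_hom_add[OF iota_hom remainder_closed[OF \<sigma>] \<kappa>]
      ker iota_remainder[OF \<sigma>] \<sigma> \<rho> by simp
  then show ?thesis
    using FHle.minus_add[OF \<sigma> \<rho>] FHle.add_comm \<sigma> \<rho> by simp
qed

lemma Phi_eq:
  assumes rec: "recursion \<kappa> \<sigma>" shows "Phi T \<rho> j \<kappa> = (\<lambda>b. proj T b (\<sigma> b))"
proof -
  obtain b0 where b0: "\<And>b. b > b0 \<Longrightarrow> \<sigma> b = rzero (FHle T b) \<and> \<kappa> b = rzero (FHle T b)"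
    using rec unfolding recursion_def by meson
  note \<kappa> = recursion_closed(2)[OF rec]
  have Phi: "\<exists>p \<tau>. (\<forall>b>p. \<kappa> b = rzero (K_at T b) \<and> proj T b (\<sigma> b) = rzero (aleph_at T b)) \<and>
     \<tau> p = \<kappa> p \<and> (\<forall>b\<le>p. proj T b (\<sigma> b) = proj T b (\<tau> b) \<and>
        \<tau> (b - 1) = radd (FHle T (b - 1))
          (j b (rminus (FHle T b) (\<tau> b) (\<rho> b (proj T b (\<sigma> b))))) (\<kappa> (b - 1)))"
  proof (intro exI conjI allI impI)
    show "\<sigma> b0 = \<kappa> b0"
      using recursion_step[OF rec, of "b0 + 1"] b0[of "b0 + 1"] remainder_0[of "b0 + 1"] \<kappa>[of b0]
      by simp
    show "\<sigma> (b - 1) = radd (FHle T (b - 1))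
        (j b (rminus (FHle T b) (\<sigma> b) (\<rho> b (proj T b (\<sigma> b))))) (\<kappa> (b - 1))" for b
      using recursion_step[OF rec, of b] by (simp add: remainder_def)
  qed (simp_all add: b0 proj_0)
  have unique: "\<eta> = (\<lambda>b. proj T b (\<sigma> b))"
    if top: "\<forall>b>p. \<kappa> b = rzero (K_at T b) \<and> \<eta> b = rzero (aleph_at T b)"
      and p: "\<tau> p = \<kappa> p"
      and step: "\<forall>b\<le>p. \<eta> b = proj T b (\<tau> b) \<and>
        \<tau> (b - 1) = radd (FHle T (b - 1))
          (j b (rminus (FHle T b) (\<tau> b) (\<rho> b (\<eta> b)))) (\<kappa> (b - 1))" for \<eta> p \<tau>
  proof -
    \<comment> \<open>The description in \<open>Phi\<close> says nothing about \<open>\<tau>\<close>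
      above \<open>p\<close>, so those values are reset to zero.\<close>
    define \<tau>' where "\<tau>' b = (if b \<le> p then \<tau> b else rzero (FHle T b))" for b
    have \<tau>_step: "\<tau> (b - 1) = radd (FHle T (b - 1)) (remainder b (\<tau> b)) (\<kappa> (b - 1))"
      if "b \<le> p" for b using step that by (simp add: remainder_def)
    have closed: "\<tau> b \<in> rcarrier (FHle T b)" if "b \<le> p" for b using that
    proof (induction b rule: int_le_induct)
      case base show ?case using p \<kappa> by simp
    next
      case (step i)
      then show ?case using \<tau>_step[of i] \<kappa> remainder_closed by simp
    qed
    have "\<tau>' (b - 1) = radd (FHle T (b - 1)) (remainder b (\<tau>' b)) (\<kappa> (b - 1))" for b
    proof -
      consider "b > p + 1" | "b = p + 1" | "b \<le> p" by linarith
      then show ?thesis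
      proof cases
        case 1 then show ?thesis using top by (simp add: \<tau>'_def remainder_0)
      next
        case 2 then show ?thesis
          using p \<kappa>[of p] remainder_0[of "p + 1"] by (simp add: \<tau>'_def)
      next
        case 3 then show ?thesis using \<tau>_step[of b] by (simp add: \<tau>'_def)
      qed
    qed
    then have "recursion \<kappa> \<tau>'"
      unfolding recursion_def
      using closed top \<kappa> by (auto simp: \<tau>'_def intro!: exI[of _ p])
    then have "\<tau>' = \<sigma>" using recursion_unique rec by blast
    moreover have "\<eta> b = proj T b (\<tau>' b)" for b
      using top step by (cases "b \<le> p") (auto simp: \<tau>'_def proj_0)
    ultimately show ?thesis by (simp add: fun_eq_iff)
  qed
  show ?thesis
    unfolding Phi_def
  proof (rule the_equality)
    fix \<eta> assume "\<exists>p \<tau>. (\<forall>b>p. \<kappa> b = rzero (K_at T b) \<and> \<eta> b = rzero (aleph_at T b)) \<and>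
     \<tau> p = \<kappa> p \<and> (\<forall>b\<le>p. \<eta> b = proj T b (\<tau> b) \<and>
        \<tau> (b - 1) = radd (FHle T (b - 1))
          (j b (rminus (FHle T b) (\<tau> b) (\<rho> b (\<eta> b)))) (\<kappa> (b - 1)))"
    then show "\<eta> = (\<lambda>b. proj T b (\<sigma> b))" using unique by blast
  qed (rule Phi)
qed

section \<open>Modules of formal sums; linearity and injectivity of \<open>Phi\<close>\<close>

lemma K_sums_iff:
  "\<kappa> \<in> rcarrier (K_sums T) \<longleftrightarrow>
    (\<forall>b. \<kappa> b \<in> rcarrier (K_at T b)) \<and> (\<exists>b0. \<forall>b>b0. \<kappa> b = rzero (FHle T b))"
  by (simp add: K_sums_def bounded_sums_def)

lemma aleph_iff:
  "\<eta> \<in> rcarrier (aleph T) \<longleftrightarrow>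
    (\<forall>b. \<eta> b \<in> rcarrier (aleph_at T b)) \<and> (\<exists>b0. \<forall>b>b0. \<eta> b = rzero (FHwin T b b))"
  by (simp add: aleph_def bounded_sums_def)

lemma F_sums_iff:
  "\<eta> \<in> rcarrier (F_sums T) \<longleftrightarrow>
    (\<forall>b. \<eta> b \<in> rcarrier (FHwin T b b)) \<and> (\<exists>b0. \<forall>b>b0. \<eta> b = rzero (FHwin T b b))"
  by (simp add: F_sums_def bounded_sums_def)

lemma sums_simps [simp]:
  "radd (K_sums T) = (\<lambda>\<kappa> \<kappa>' b. radd (FHle T b) (\<kappa> b) (\<kappa>' b))"
  "rzero (K_sums T) = (\<lambda>b. rzero (FHle T b))"
  "rscale (K_sums T) = (\<lambda>\<kappa> r b. rscale (FHle T b) (\<kappa> b) r)"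
  "radd (F_sums T) = (\<lambda>\<eta> \<eta>' b. radd (FHwin T b b) (\<eta> b) (\<eta>' b))"
  "rzero (F_sums T) = (\<lambda>b. rzero (FHwin T b b))"
  "rscale (F_sums T) = (\<lambda>\<eta> r b. rscale (FHwin T b b) (\<eta> b) r)"
  by (simp_all add: K_sums_def F_sums_def bounded_sums_def)

lemma aleph_F_sums: "aleph T = (F_sums T)\<lparr>rcarrier := rcarrier (aleph T)\<rparr>"
  by (simp add: aleph_def F_sums_def bounded_sums_def)

lemma right_module_K_sums: "right_module (K_sums T)"
  unfolding K_sums_def by (intro bounded_sums_right_module right_module_K_at)

lemma right_module_F_sums: "right_module (F_sums T)"
  unfolding F_sums_def by (intro bounded_sums_right_module FHwin.right_module_axioms)

lemma right_module_aleph: "right_module (aleph T)"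
  unfolding aleph_def by (intro bounded_sums_right_module right_module_aleph_at)

lemma aleph_simps [simp]:
  "radd (aleph T) = radd (F_sums T)" "rzero (aleph T) = rzero (F_sums T)"
  "rscale (aleph T) = rscale (F_sums T)"
  by (subst aleph_F_sums, simp)+

lemma aleph_subset: "\<eta> \<in> rcarrier (aleph T) \<Longrightarrow> \<eta> \<in> rcarrier (F_sums T)"
  using aleph_at_carrier_win by (auto simp: aleph_iff F_sums_iff)

lemma K_recursion:
  assumes "\<kappa> \<in> rcarrier (K_sums T)" obtains \<sigma> where "recursion \<kappa> \<sigma>"
proof -
  obtain b0 where "\<forall>b>b0. \<kappa> b = rzero (FHle T b)" using assms by (auto simp: K_sums_iff)
  then show ?thesis
    using recursion_exists[of \<kappa> b0] that assms K_at_carrier_le by (auto simp: K_sums_iff)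
qed

lemma K_sums_kernel:
  assumes "\<kappa> \<in> rcarrier (K_sums T)" shows "iota T b (\<kappa> (b - 1)) = rzero (FHle T b)"
  using assms K_at_carrier[of b] by (auto simp: K_sums_iff)

text \<open>Sums and multiples of solutions solve the recursion for the sums and multiples of the
  \<open>\<kappa>\<close>, and \<open>proj\<close> is linear.\<close>

lemma Phi_hom: "Phi T \<rho> j \<in> rmod_hom (K_sums T) (aleph T)"
  unfolding rmod_hom_def
proof (intro CollectI conjI ballI allI)
  fix \<kappa> \<kappa>' r
  assume \<kappa>: "\<kappa> \<in> rcarrier (K_sums T)"
  then obtain \<sigma> where \<sigma>: "recursion \<kappa> \<sigma>" by (rule K_recursion)
  note closed = recursion_closed[OF \<sigma>]
  obtain p where p: "\<And>b. b > p \<Longrightarrow> \<sigma> b = rzero (FHle T b) \<and> \<kappa> b = rzero (FHle T b)"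
    using \<sigma> unfolding recursion_def by meson
  show "Phi T \<rho> j \<kappa> \<in> rcarrier (aleph T)"
    unfolding Phi_eq[OF \<sigma>] aleph_iff using closed proj_aleph p proj_0 by metis
  have "recursion (rscale (K_sums T) \<kappa> r) (\<lambda>b. rscale (FHle T b) (\<sigma> b) r)"
    unfolding recursion_def
    using closed p recursion_step[OF \<sigma>]
    by (auto simp: rmod_hom_scale[OF remainder_hom] FHle.scale_add remainder_closed
        intro!: exI[of _ p])
  from Phi_eq[OF this]
  show "Phi T \<rho> j (rscale (K_sums T) \<kappa> r) = rscale (aleph T) (Phi T \<rho> j \<kappa>) r"
    using closed by (simp add: Phi_eq[OF \<sigma>] rmod_hom_scale[OF proj_hom])
  assume \<kappa>': "\<kappa>' \<in> rcarrier (K_sums T)"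
  then obtain \<sigma>' where \<sigma>': "recursion \<kappa>' \<sigma>'" by (rule K_recursion)
  note closed' = recursion_closed[OF \<sigma>']
  obtain q where q: "\<And>b. b > q \<Longrightarrow> \<sigma>' b = rzero (FHle T b) \<and> \<kappa>' b = rzero (FHle T b)"
    using \<sigma>' unfolding recursion_def by meson
  have "recursion (radd (K_sums T) \<kappa> \<kappa>') (\<lambda>b. radd (FHle T b) (\<sigma> b) (\<sigma>' b))"
    unfolding recursion_def
    using closed closed' p q recursion_step[OF \<sigma>] recursion_step[OF \<sigma>']
    by (auto simp: rmod_hom_add[OF remainder_hom] FHle.add_4 remainder_closed
        intro!: exI[of _ "max p q"])
  from Phi_eq[OF this]
  show "Phi T \<rho> j (radd (K_sums T) \<kappa> \<kappa>') = radd (aleph T) (Phi T \<rho> j \<kappa>) (Phi T \<rho> j \<kappa>')"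
    using closed closed'
    by (simp add: Phi_eq[OF \<sigma>] Phi_eq[OF \<sigma>'] rmod_hom_add[OF proj_hom])
qed

text \<open>If \<open>\<Phi> \<kappa> = 0\<close>, then each \<open>\<sigma>\<^sup>b\<close> lies in the image of \<open>FH\<^sup>a\<close> compatibly for all \<open>a < b\<close>, and
  completeness forces \<open>\<sigma>\<^sup>b = 0\<close>.\<close>

lemma Phi_eq_0:
  assumes \<kappa>: "\<kappa> \<in> rcarrier (K_sums T)" and 0: "Phi T \<rho> j \<kappa> = rzero (F_sums T)"
  shows "\<kappa> = rzero (K_sums T)"
proof -
  obtain \<sigma> where \<sigma>: "recursion \<kappa> \<sigma>" using \<kappa> by (rule K_recursion)
  note closed = recursion_closed[OF \<sigma>]
  have "proj T b (\<sigma> b) = rzero (FHwin T b b)" for b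
    using 0 Phi_eq[OF \<sigma>] by (simp add: fun_eq_iff)
  then have z: "cls_le T b 0 = \<rho> b (proj T b (\<sigma> b))" for b by (simp add: rho_0 FHle_zero)
  have "\<sigma> b = cls_le T b (series T b (\<lambda>_. 0))" for b
  proof (rule cls_series)
    show "\<sigma> b = radd (FHle T b) (cls_le T b 0) (iota T b (\<sigma> (b - 1)))" for b
      unfolding z by (rule recursion_iota[OF \<sigma> K_sums_kernel[OF \<kappa>]])
  qed (rule closed Z_closed(1))+
  then have \<sigma>0: "\<sigma> b = rzero (FHle T b)" for b
    by (simp add: FHle_zero series_def zero_fun_def)
  \<comment> \<open>With all \<open>\<sigma>\<close> zero, the recursion at \<open>b + 1\<close>
    leaves only \<open>\<kappa> b\<close>.\<close>
  have "\<kappa> b = rzero (FHle T b)" for b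
    using recursion_step[OF \<sigma>, of "b + 1"] \<sigma>0[of b] \<sigma>0[of "b + 1"] closed(2)[of b]
      remainder_0[of "b + 1"] by simp
  then show ?thesis by (simp add: fun_eq_iff)
qed

section \<open>Representing cycles and the value of \<open>Psi\<close>\<close>

definition represents where
  "represents s \<eta> \<longleftrightarrow> (\<forall>b. s b \<in> Z b \<and> cls_le T b (s b) = \<rho> b (\<eta> b))"

text \<open>Cycles are chosen at all indices at once, so one family serves every upper limit of
  \<open>series\<close>.\<close>

lemma represents_exists:
  assumes "\<eta> \<in> rcarrier (aleph T)" shows "\<exists>s. represents s \<eta>"
proof -
  have "\<forall>b. \<exists>s. s \<in> Z b \<and> cls_le T b s = \<rho> b (\<eta> b)"
    using assms rho_closed FHle_cases unfolding aleph_iff by metis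
  then show ?thesis unfolding represents_def by metis
qed

text \<open>\<open>telescope\<close> is applied to the partial sums of \<open>s\<close> against the
  terms \<open>t b\<close>: each step then contributes \<open>s b - t b\<close>, which is a
  boundary.\<close>

lemma series_cls_cong:
  assumes s: "\<And>b. b \<le> b0 \<Longrightarrow> s b \<in> Z b" and t: "\<And>b. b \<le> b0 \<Longrightarrow> t b \<in> Z b"
    and eq: "\<And>b. b \<le> b0 \<Longrightarrow> cls_le T b (s b) = cls_le T b (t b)"
  shows "cls_le T b0 (series T b0 s) = cls_le T b0 (series T b0 t)"
proof -
  have "series T b s - t b - series T (b - 1) s \<in> diff T ` C b" if "b \<le> b0" for b
  proof -
    have "series T b s - t b - series T (b - 1) s = s b - t b"
      using series_step[of s b] s[OF that] by (simp add: Z_iff)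
    moreover have "s b - t b \<in> diff T ` C b" using eq[OF that] s[OF that] t[OF that] by (simp add: cls_le_eq_iff)
    ultimately show ?thesis by (simp only:)
  qed
  moreover have cyc: "series T b s \<in> Z b" "series T b t \<in> Z b" if "b \<le> b0" for b
    using s t that by (simp_all add: series_cycle)
  ultimately have "series T b0 s - series T b0 t \<in> diff T ` C b0"
    using t by (intro telescope[where t = "\<lambda>b. series T b s"]) (auto simp: Z_C)
  then show ?thesis using cyc[of b0] by (simp add: cls_le_eq_iff)
qed

text \<open>Two choices of limit and cycles are padded with zeros to the limit \<open>B\<close>.
  They then agree in homology at each index up to \<open>B\<close>, so their sums define the same
  class there and hence in \<open>FH\<close>.\<close>

lemma Psi_eq:
  assumes top: "\<And>b. b > b0 \<Longrightarrow> \<eta> b = rzero (FHwin T b b)"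
    and s: "\<And>b. b \<le> b0 \<Longrightarrow> s b \<in> Z b \<and> cls_le T b (s b) = \<rho> b (\<eta> b)"
  shows "Psi T \<rho> \<eta> = cls T (series T b0 s)"
proof -
  have "X = cls T (series T b0 s)"
    if top': "\<forall>b>b1. \<eta> b = rzero (aleph_at T b)"
      and t: "\<forall>b\<le>b1. t b \<in> Z b \<and> cls_le T b (t b) = \<rho> b (\<eta> b)"
      and X: "X = cls T (series T b1 t)" for X b1 t
  proof -
    define B where "B = max b0 b1"
    \<comment> \<open>Above \<open>p\<close> the zero chain represents \<open>\<rho>\<close> of
      zero.\<close>
    have rep: "(if b \<le> p then u b else 0) \<in> Z b \<and>
        cls_le T b (if b \<le> p then u b else 0) = \<rho> b (\<eta> b)"
      if "\<forall>b>p. \<eta> b = rzero (FHwin T b b)" "\<forall>b\<le>p. u b \<in> Z b \<and> cls_le T b (u b) = \<rho> b (\<eta> b)"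
      for b p u
      using that by (auto simp: rho_0 FHle_zero)
    have "cls_le T B (series T B (\<lambda>b. if b \<le> b0 then s b else 0)) =
        cls_le T B (series T B (\<lambda>b. if b \<le> b1 then t b else 0))"
      using rep[of b0 s] rep[of b1 t] top s top' t by (intro series_cls_cong) auto
    then have eq: "cls_le T B (series T b0 s) = cls_le T B (series T b1 t)"
      by (simp add: series_extend B_def)
    have "series T b0 s \<in> Z B" "series T b1 t \<in> Z B"
      using s t series_cycle[of b0 s] series_cycle[of b1 t]
      by (auto intro: Z_mono[of b0] Z_mono[of b1] simp: B_def)
    then show ?thesis using X eq iota_lim_cls by metis
  qed
  then show ?thesis
    unfolding Psi_def using top s by (intro the_equality) auto
qed

section \<open>Linearity, kernel and filtration behaviour of \<open>Psi\<close>\<close>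

lemma aleph_bound:
  assumes "\<eta> \<in> rcarrier (aleph T)"
  obtains b0 where "\<And>b. b > b0 \<Longrightarrow> \<eta> b = rzero (FHwin T b b)"
  using assms by (auto simp: aleph_iff)

lemma cls_tot: "s \<in> Z b \<Longrightarrow> s \<in> cycles (FC T) (diff T)"
  using Ztot_iff by blast

lemma Psi_hom: "Psi T \<rho> \<in> rmod_hom (aleph T) (FH T)"
  unfolding rmod_hom_def
proof (intro CollectI conjI ballI allI)
  fix \<eta> \<theta> r
  assume \<eta>: "\<eta> \<in> rcarrier (aleph T)"
  then obtain p where p: "\<And>b. b > p \<Longrightarrow> \<eta> b = rzero (FHwin T b b)" using aleph_bound by blast
  obtain s where s: "\<And>b. s b \<in> Z b" "\<And>b. cls_le T b (s b) = \<rho> b (\<eta> b)"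
    using represents_exists[OF \<eta>] by (auto simp: represents_def)
  have \<eta>b: "\<eta> b \<in> rcarrier (aleph_at T b)" for b using \<eta> by (simp add: aleph_iff)
  have Zs: "series T b0 s \<in> Z b0" for b0 using s by (simp add: series_cycle)
  show "Psi T \<rho> \<eta> \<in> rcarrier (FH T)"
    using Psi_eq[of p \<eta> s] p s cls_tot[OF Zs[of p]] by (simp add: FH_carrier)
  have "Psi T \<rho> (rscale (aleph T) \<eta> r) = cls T (series T p (\<lambda>b c. s b c * r))"
    using p s \<eta>b rmod_hom_scale[OF rho_hom \<eta>b]
    by (intro Psi_eq) (simp_all add: FHle_scale[symmetric])
  then show "Psi T \<rho> (rscale (aleph T) \<eta> r) = rscale (FH T) (Psi T \<rho> \<eta>) r"
    using Psi_eq[of p \<eta> s] p s cls_tot[OF Zs[of p]] by (simp add: FH_scale series_scale)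
  assume \<theta>: "\<theta> \<in> rcarrier (aleph T)"
  then obtain q where q: "\<And>b. b > q \<Longrightarrow> \<theta> b = rzero (FHwin T b b)" using aleph_bound by blast
  obtain t where t: "\<And>b. t b \<in> Z b" "\<And>b. cls_le T b (t b) = \<rho> b (\<theta> b)"
    using represents_exists[OF \<theta>] by (auto simp: represents_def)
  have \<theta>b: "\<theta> b \<in> rcarrier (aleph_at T b)" for b using \<theta> by (simp add: aleph_iff)
  have Zt: "series T b0 t \<in> Z b0" for b0 using t by (simp add: series_cycle)
  let ?m = "max p q"
  have "Psi T \<rho> (radd (aleph T) \<eta> \<theta>) = cls T (series T ?m (\<lambda>b. s b + t b))"
    using p q s t \<eta>b \<theta>b rmod_hom_add[OF rho_hom \<eta>b \<theta>b]
    by (intro Psi_eq) (simp_all add: FHle_add[symmetric])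
  moreover have "Psi T \<rho> \<eta> = cls T (series T ?m s)" "Psi T \<rho> \<theta> = cls T (series T ?m t)"
    using p q s t by (simp_all add: Psi_eq)
  ultimately show "Psi T \<rho> (radd (aleph T) \<eta> \<theta>) = radd (FH T) (Psi T \<rho> \<eta>) (Psi T \<rho> \<theta>)"
    using cls_tot[OF Zs[of ?m]] cls_tot[OF Zt[of ?m]] by (simp add: FH_add series_plus)
qed

text \<open>The series representing \<open>Psi\<close> of \<open>Phi \<kappa>\<close> has class
  \<open>\<sigma>\<close> at every index; at \<open>p + 1\<close> this class is zero, so the series
  bounds.\<close>

lemma Psi_Phi:
  assumes \<kappa>: "\<kappa> \<in> rcarrier (K_sums T)" shows "Psi T \<rho> (Phi T \<rho> j \<kappa>) = rzero (FH T)"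
proof -
  obtain \<sigma> where \<sigma>: "recursion \<kappa> \<sigma>" using \<kappa> by (rule K_recursion)
  note closed = recursion_closed[OF \<sigma>]
  define \<eta> where "\<eta> = Phi T \<rho> j \<kappa>"
  have \<eta>: "\<eta> \<in> rcarrier (aleph T)" using rmod_hom_closed[OF Phi_hom \<kappa>] by (simp add: \<eta>_def)
  have \<eta>b: "\<eta> b = proj T b (\<sigma> b)" for b by (simp add: \<eta>_def Phi_eq[OF \<sigma>])
  obtain p where p: "\<And>b. b > p \<Longrightarrow> \<sigma> b = rzero (FHle T b)"
    using \<sigma> unfolding recursion_def by meson
  obtain s where s: "\<And>b. s b \<in> Z b" "\<And>b. cls_le T b (s b) = \<rho> b (\<eta> b)"
    using represents_exists[OF \<eta>] by (auto simp: represents_def)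
  have "\<sigma> (p + 1) = cls_le T (p + 1) (series T (p + 1) s)"
  proof (rule cls_series)
    show "\<sigma> b = radd (FHle T b) (cls_le T b (s b)) (iota T b (\<sigma> (b - 1)))" for b
      unfolding s \<eta>b by (rule recursion_iota[OF \<sigma> K_sums_kernel[OF \<kappa>]])
  qed (simp_all add: s closed)
  then have "cls_le T (p + 1) (series T (p + 1) s) = rzero (FHle T (p + 1))"
    using p[of "p + 1"] by simp
  then have "series T (p + 1) s \<in> diff T ` C (p + 1)"
    using series_cycle[of "p + 1" s] s by (simp add: cls_le_eq_0_iff)
  moreover have "Psi T \<rho> \<eta> = cls T (series T (p + 1) s)"
    using s p by (intro Psi_eq) (auto simp: \<eta>b proj_0)
  ultimately show ?thesis
    using cls_eq_0_iff[OF series_cycle[of "p + 1" s]] s by (auto simp: \<eta>_def)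
qed

text \<open>The classes \<open>\<tau> b\<close> of the partial sums have leading parts
  \<open>\<eta> b\<close>. They vanish for large \<open>b\<close> because the full series bounds,
  and they solve the recursion for a suitable \<open>\<kappa>\<close>, so that
  \<open>Phi \<kappa> = \<eta>\<close>.\<close>

lemma Psi_kernel:
  assumes \<eta>: "\<eta> \<in> rcarrier (aleph T)" and 0: "Psi T \<rho> \<eta> = rzero (FH T)"
  shows "\<eta> \<in> Phi T \<rho> j ` rcarrier (K_sums T)"
proof -
  obtain p where p: "\<And>b. b > p \<Longrightarrow> \<eta> b = rzero (FHwin T b b)" using aleph_bound[OF \<eta>] by blast
  obtain s0 where s0: "\<And>b. s0 b \<in> Z b" "\<And>b. cls_le T b (s0 b) = \<rho> b (\<eta> b)"
    using represents_exists[OF \<eta>] by (auto simp: represents_def)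
  define s where "s b = (if b \<le> p then s0 b else 0)" for b
  have s: "s b \<in> Z b" "cls_le T b (s b) = \<rho> b (\<eta> b)" for b
    using s0 p by (auto simp: s_def rho_0 FHle_zero)
  have Zs: "series T b s \<in> Z b" for b using s by (simp add: series_cycle)
  have "Psi T \<rho> \<eta> = cls T (series T p s)" using p s by (intro Psi_eq) auto
  then obtain a where a: "series T p s \<in> diff T ` C a"
    using 0 cls_eq_0_iff[OF Zs[of p]] by auto
  have const: "series T b s = series T p s" if "b \<ge> p" for b
    using series_extend[OF that, of s0] series_extend[of p p s0]
    unfolding s_def[abs_def] by simp
  define \<tau> where "\<tau> b = cls_le T b (series T b s)" for b
  have \<tau>: "\<tau> b \<in> rcarrier (FHle T b)" for b using Zs by (simp add: \<tau>_def)
  \<comment> \<open>Above \<open>p\<close> the partial sum is the full series, and from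
    \<open>a\<close> on the chain bounding it is available.\<close>
  have \<tau>0: "\<tau> b = rzero (FHle T b)" if "b > max p a" for b
    using that a const[of b] boundary_mono[of a b "series T p s"] Zs[of b]
    by (simp add: \<tau>_def cls_le_eq_0_iff)
  have Zs1: "series T (b - 1) s \<in> Z b" for b using Zs[of "b - 1"] by (rule Z_mono[rotated]) simp
  have step: "series T b s = s b + series T (b - 1) s" for b
    using s by (intro series_step) (auto simp: Z_C)
  have \<tau>_step: "\<tau> b = radd (FHle T b) (\<rho> b (\<eta> b)) (iota T b (\<tau> (b - 1)))" for b
    using step[of b] s[of b] Zs[of "b - 1"] Zs1[of b]
    by (simp add: \<tau>_def iota_cls FHle_add flip: s(2))
  have proj_\<tau>: "proj T b (\<tau> b) = \<eta> b" for b
  proof -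
    have "trunc T b (series T (b - 1) s) = 0"
      using Zs[of "b - 1"] Zs1[of b] by (simp add: trunc_eq_0_iff Z_C)
    then have "proj T b (\<tau> b) = cls_win T b b (trunc T b (s b))"
      using Zs[of b] step[of b] by (simp add: \<tau>_def proj_cls trunc_linear)
    also have "\<dots> = proj T b (\<rho> b (\<eta> b))" using s[of b] by (simp add: proj_cls flip: s(2))
    finally show ?thesis using proj_rho \<eta> by (simp add: aleph_iff)
  qed
  \<comment> \<open>\<open>\<kappa>\<close> is the defect of \<open>\<tau>\<close> in the recursion,
    so \<open>\<tau>\<close> solves it by construction; what has to be shown is that
    \<open>\<kappa>\<close> lies in \<open>K_sums T\<close>.\<close>
  define \<kappa> where "\<kappa> b = rminus (FHle T b) (\<tau> b) (remainder (b + 1) (\<tau> (b + 1)))" for b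
  have rem: "remainder (b + 1) (\<tau> (b + 1)) \<in> rcarrier (FHle T b)" for b
    using remainder_closed[OF \<tau>, of "b + 1"] by simp
  have \<kappa>_le: "\<kappa> b \<in> rcarrier (FHle T b)" for b using \<tau> rem by (simp add: \<kappa>_def)
  have \<kappa>0: "\<kappa> b = rzero (FHle T b)" if "b > max p a" for b
    using that remainder_0[of "b + 1"] by (simp add: \<kappa>_def \<tau>0)
  \<comment> \<open>Both terms of \<open>\<kappa> (b - 1)\<close> are sent by \<open>iota\<close> to
    \<open>\<tau> b\<close> minus \<open>\<rho>\<close> of \<open>\<eta> b\<close>; exactness then
    places \<open>\<kappa>\<close> in the image of \<open>conn\<close>.\<close>
  have "iota T b (\<kappa> (b - 1)) = rzero (FHle T b)" for b
  proof -
    have \<rho>: "\<rho> b (\<eta> b) \<in> rcarrier (FHle T b)" using rho_closed \<eta> by (simp add: aleph_iff)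
    have \<iota>: "iota T b (\<tau> (b - 1)) \<in> rcarrier (FHle T b)" using rmod_hom_closed[OF iota_hom \<tau>] .
    have "iota T b (\<kappa> (b - 1)) = rminus (FHle T b) (iota T b (\<tau> (b - 1)))
        (iota T b (remainder b (\<tau> b)))"
      using rmod_hom_minus[OF FHle.right_module_axioms iota_hom \<tau> remainder_closed[OF \<tau>], of b]
      by (simp add: \<kappa>_def)
    also have "iota T b (remainder b (\<tau> b)) = rminus (FHle T b) (\<tau> b) (\<rho> b (\<eta> b))"
      by (simp add: iota_remainder[OF \<tau>] proj_\<tau>)
    also have "\<dots> = iota T b (\<tau> (b - 1))"
      unfolding FHle.minus_eq_iff[OF \<tau> \<rho> \<iota>] by (rule \<tau>_step)
    finally show ?thesis using \<iota> by simp
  qed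
  then have "\<kappa> (b - 1) \<in> rcarrier (K_at T (b - 1))" for b
    using K_at_carrier \<kappa>_le by auto
  from this[of "b + 1" for b] have "\<kappa> \<in> rcarrier (K_sums T)"
    using \<kappa>0 by (auto simp: K_sums_iff intro!: exI[of _ "max p a"])
  moreover have "recursion \<kappa> \<tau>"
    unfolding recursion_def
  proof (intro conjI allI exI impI)
    fix b show "\<tau> (b - 1) = radd (FHle T (b - 1)) (remainder b (\<tau> b)) (\<kappa> (b - 1))"
      using FHle.minus_eq_iff[OF \<tau> remainder_closed[OF \<tau>] \<kappa>_le, of b] by (simp add: \<kappa>_def)
    show "\<tau> b = rzero (FHle T b)" "\<kappa> b = rzero (FHle T b)" if "b > max p a" using that \<tau>0 \<kappa>0 by auto
  qed (use \<tau> \<kappa>_le in auto)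
  then have "Phi T \<rho> j \<kappa> = \<eta>" using Phi_eq proj_\<tau> by simp
  ultimately show ?thesis by blast
qed

text \<open>A series with limit \<open>p\<close> is bounded by \<open>p\<close>. Conversely the
  recursion started at the class of a cycle \<open>z\<close> bounded by \<open>p\<close> produces
  leading parts whose series represents that class again.\<close>

lemma Psi_filtration:
  "Psi T \<rho> ` {\<eta> \<in> rcarrier (aleph T). \<forall>b>p. \<eta> b = rzero (FHwin T b b)} = FH_filt T p"
proof (intro equalityI subsetI)
  fix X assume "X \<in> Psi T \<rho> ` {\<eta> \<in> rcarrier (aleph T). \<forall>b>p. \<eta> b = rzero (FHwin T b b)}"
  then obtain \<eta> where \<eta>: "\<eta> \<in> rcarrier (aleph T)" "\<And>b. b > p \<Longrightarrow> \<eta> b = rzero (FHwin T b b)"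
    and X: "X = Psi T \<rho> \<eta>" by blast
  obtain s where s: "\<And>b. s b \<in> Z b" "\<And>b. cls_le T b (s b) = \<rho> b (\<eta> b)"
    using represents_exists[OF \<eta>(1)] by (auto simp: represents_def)
  have Zs: "series T p s \<in> Z p" using s by (simp add: series_cycle)
  have "X = iota_lim T (cls_le T p (series T p s))"
    using Psi_eq[of p \<eta> s] \<eta> s X iota_lim_cls[OF Zs] by simp
  then show "X \<in> FH_filt T p" using Zs by (simp add: FH_filt_def)
next
  fix X assume "X \<in> FH_filt T p"
  then obtain z where z: "z \<in> Z p" "X = cls T z"
    by (auto simp: FH_filt_def iota_lim_cls elim!: FHle_cases)
  \<comment> \<open>Placing the class of \<open>z\<close> at index \<open>p\<close> makes it the
    initial value of the recursion; it need not lie in \<open>K_at T p\<close>.\<close>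
  define \<kappa> where "\<kappa> b = (if b = p then cls_le T p z else rzero (FHle T b))" for b
  obtain \<sigma> where \<sigma>: "recursion \<kappa> \<sigma>" and top: "\<And>b. b > p \<Longrightarrow> \<sigma> b = rzero (FHle T b)"
  proof -
    have "\<kappa> b \<in> rcarrier (FHle T b)" for b using z by (simp add: \<kappa>_def)
    moreover have "\<kappa> b = rzero (FHle T b)" if "b > p" for b using that by (simp add: \<kappa>_def)
    ultimately show ?thesis using recursion_exists[of \<kappa> p] that by blast
  qed
  note closed = recursion_closed[OF \<sigma>]
  have \<sigma>p: "\<sigma> p = cls_le T p z"
    using recursion_step[OF \<sigma>, of "p + 1"] top[of "p + 1"] remainder_0[of "p + 1"] z
    by (simp add: \<kappa>_def)
  define \<eta> where "\<eta> b = proj T b (\<sigma> b)" for b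
  have \<eta>: "\<eta> \<in> rcarrier (aleph T)" "\<forall>b>p. \<eta> b = rzero (FHwin T b b)"
    using closed proj_aleph top by (auto simp: \<eta>_def aleph_iff proj_0 intro!: exI[of _ p])
  obtain s where s: "\<And>b. s b \<in> Z b" "\<And>b. cls_le T b (s b) = \<rho> b (\<eta> b)"
    using represents_exists[OF \<eta>(1)] by (auto simp: represents_def)
  \<comment> \<open>Below the start, \<open>\<kappa>\<close> is zero, which suffices for recovering
    \<open>\<sigma> p\<close>.\<close>
  have ker: "iota T b (\<kappa> (b - 1)) = rzero (FHle T b)" if "b \<le> p" for b
    using that rmod_hom_zero[OF FHle.right_module_axioms FHle.right_module_axioms iota_hom]
    by (simp add: \<kappa>_def)
  have "\<sigma> p = cls_le T p (series T p s)"
  proof (rule cls_series)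
    show "\<sigma> b = radd (FHle T b) (cls_le T b (s b)) (iota T b (\<sigma> (b - 1)))" if "b \<le> p" for b
      unfolding s \<eta>_def by (rule recursion_iota[OF \<sigma> ker[OF that]])
  qed (simp_all add: s closed)
  then have "cls_le T p z = cls_le T p (series T p s)" by (simp add: \<sigma>p)
  then have "cls T z = cls T (series T p s)"
    using iota_lim_cls[OF z(1)] iota_lim_cls[OF series_cycle[of p s]] s by simp
  then have "X = Psi T \<rho> \<eta>" using Psi_eq[of p \<eta> s] \<eta> s z by simp
  then show "X \<in> Psi T \<rho> ` {\<eta> \<in> rcarrier (aleph T). \<forall>b>p. \<eta> b = rzero (FHwin T b b)}"
    using \<eta> by blast
qed

section \<open>The differential \<open>\<partial>\<close>\<close>

lemma conn_sums_hom: "conn_sums T \<in> rmod_hom (F_sums T) (K_sums T)"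
  unfolding rmod_hom_def
proof (intro CollectI conjI ballI allI)
  fix \<eta> \<theta> r assume \<eta>: "\<eta> \<in> rcarrier (F_sums T)"
  then obtain p where p: "\<forall>b>p. \<eta> b = rzero (FHwin T b b)" by (auto simp: F_sums_iff)
  have "conn T (b + 1) (rzero (FHwin T (b + 1) (b + 1))) = rzero (FHle T b)" for b
    using rmod_hom_zero[OF FHwin.right_module_axioms FHle.right_module_axioms conn_hom, of "b + 1"]
    by simp
  then show "conn_sums T \<eta> \<in> rcarrier (K_sums T)"
    using \<eta> p by (auto simp: K_sums_iff F_sums_iff conn_sums_def K_at_def intro!: exI[of _ p])
  have \<eta>b: "\<eta> b \<in> rcarrier (FHwin T b b)" for b using \<eta> by (simp add: F_sums_iff)
  show "conn_sums T (rscale (F_sums T) \<eta> r) = rscale (K_sums T) (conn_sums T \<eta>) r"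
    using rmod_hom_scale[OF conn_hom \<eta>b, of "b + 1" for b] by (simp add: conn_sums_def)
  assume "\<theta> \<in> rcarrier (F_sums T)"
  then have \<theta>b: "\<theta> b \<in> rcarrier (FHwin T b b)" for b by (simp add: F_sums_iff)
  show "conn_sums T (radd (F_sums T) \<eta> \<theta>) =
      radd (K_sums T) (conn_sums T \<eta>) (conn_sums T \<theta>)"
    using rmod_hom_add[OF conn_hom \<eta>b \<theta>b, of "b + 1" for b] by (simp add: conn_sums_def)
qed

lemma conn_sums_eq_0_iff:
  assumes "\<eta> \<in> rcarrier (F_sums T)"
  shows "conn_sums T \<eta> = rzero (K_sums T) \<longleftrightarrow> \<eta> \<in> rcarrier (aleph T)"
proof -
  have "conn_sums T \<eta> = rzero (K_sums T) \<longleftrightarrow> (\<forall>b. conn T (b + 1) (\<eta> (b + 1)) = rzero (FHle T b))"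
    by (simp add: conn_sums_def fun_eq_iff)
  also have "\<dots> \<longleftrightarrow> (\<forall>b. conn T b (\<eta> b) = rzero (FHle T (b - 1)))"
    by (metis add_diff_cancel diff_add_cancel)
  finally show ?thesis using assms by (auto simp: aleph_iff F_sums_iff aleph_at_def)
qed

text \<open>Preimages are chosen componentwise. Zero is lifted to zero, which keeps the lifted
  family bounded above.\<close>

lemma conn_sums_image: "conn_sums T ` rcarrier (F_sums T) = rcarrier (K_sums T)"
proof (intro equalityI subsetI)
  fix \<kappa> assume \<kappa>: "\<kappa> \<in> rcarrier (K_sums T)"
  then obtain p where p: "\<forall>b>p. \<kappa> b = rzero (FHle T b)" by (auto simp: K_sums_iff)
  have "\<forall>b. \<exists>X. X \<in> rcarrier (FHwin T (b + 1) (b + 1)) \<and> conn T (b + 1) X = \<kappa> b \<and>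
      (\<kappa> b = rzero (FHle T b) \<longrightarrow> X = rzero (FHwin T (b + 1) (b + 1)))"
  proof
    fix b
    have 0: "conn T (b + 1) (rzero (FHwin T (b + 1) (b + 1))) = rzero (FHle T b)"
      using rmod_hom_zero[OF FHwin.right_module_axioms FHle.right_module_axioms conn_hom, of "b + 1"]
      by simp
    have "\<kappa> b \<in> conn T (b + 1) ` rcarrier (FHwin T (b + 1) (b + 1))"
      using \<kappa> by (simp add: K_sums_iff K_at_def)
    then show "\<exists>X. X \<in> rcarrier (FHwin T (b + 1) (b + 1)) \<and> conn T (b + 1) X = \<kappa> b \<and>
      (\<kappa> b = rzero (FHle T b) \<longrightarrow> X = rzero (FHwin T (b + 1) (b + 1)))"
      using 0 FHwin.zero_closed[of "b + 1"] by (cases "\<kappa> b = rzero (FHle T b)") auto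
  qed
  then obtain X where X: "\<And>b. X b \<in> rcarrier (FHwin T (b + 1) (b + 1))"
      "\<And>b. conn T (b + 1) (X b) = \<kappa> b"
      "\<And>b. \<kappa> b = rzero (FHle T b) \<Longrightarrow> X b = rzero (FHwin T (b + 1) (b + 1))"
    by metis
  \<comment> \<open>\<open>conn\<close> lowers the index by one, so the preimage of
    \<open>\<kappa> b\<close> belongs at index \<open>b + 1\<close> and the bound moves from
    \<open>p\<close> to \<open>p + 1\<close>.\<close>
  have "(\<lambda>b. X (b - 1)) \<in> rcarrier (F_sums T)"
    unfolding F_sums_iff
  proof (intro conjI allI exI impI)
    show "X (b - 1) \<in> rcarrier (FHwin T b b)" for b using X(1)[of "b - 1"] by simp
    show "X (b - 1) = rzero (FHwin T b b)" if "b > p + 1" for b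
      using X(3)[of "b - 1"] p that by simp
  qed
  moreover have "conn_sums T (\<lambda>b. X (b - 1)) = \<kappa>" using X(2) by (simp add: conn_sums_def)
  ultimately show "\<kappa> \<in> conn_sums T ` rcarrier (F_sums T)" by blast
qed (use rmod_hom_closed[OF conn_sums_hom] in blast)

section \<open>Cycles, boundaries and homology of \<open>bdry\<close>\<close>

lemma bdry_aleph: "\<eta> \<in> rcarrier (F_sums T) \<Longrightarrow> bdry T \<rho> j \<eta> \<in> rcarrier (aleph T)"
  unfolding bdry_def comp_def
  using rmod_hom_closed[OF Phi_hom] rmod_hom_closed[OF conn_sums_hom] by blast

lemma bdry_hom: "bdry T \<rho> j \<in> rmod_hom (F_sums T) (F_sums T)"
proof -
  have "bdry T \<rho> j \<in> rmod_hom (F_sums T) (aleph T)"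
    unfolding bdry_def using conn_sums_hom Phi_hom by (rule rmod_hom_comp)
  then show ?thesis using aleph_subset by (simp add: rmod_hom_def)
qed

lemma Phi_0: "Phi T \<rho> j (rzero (K_sums T)) = rzero (F_sums T)"
  using rmod_hom_zero[OF right_module_K_sums right_module_aleph Phi_hom] by simp

text \<open>\<open>Phi\<close> has trivial kernel, so the cycles are the elements killed by
  \<open>conn_sums T\<close>, and these form \<open>aleph T\<close>.\<close>

lemma cycles_bdry: "cycles (F_sums T) (bdry T \<rho> j) = rcarrier (aleph T)"
proof (intro equalityI subsetI)
  fix \<eta> assume "\<eta> \<in> cycles (F_sums T) (bdry T \<rho> j)"
  then have \<eta>: "\<eta> \<in> rcarrier (F_sums T)" "Phi T \<rho> j (conn_sums T \<eta>) = rzero (F_sums T)"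
    by (simp_all add: cycles_def bdry_def)
  then have "conn_sums T \<eta> = rzero (K_sums T)"
    using Phi_eq_0 rmod_hom_closed[OF conn_sums_hom] by blast
  then show "\<eta> \<in> rcarrier (aleph T)" using \<eta> conn_sums_eq_0_iff by blast
next
  fix \<eta> assume "\<eta> \<in> rcarrier (aleph T)"
  then have "\<eta> \<in> rcarrier (F_sums T)" "conn_sums T \<eta> = rzero (K_sums T)"
    using aleph_subset conn_sums_eq_0_iff by blast+
  then show "\<eta> \<in> cycles (F_sums T) (bdry T \<rho> j)"
    using Phi_0 by (simp add: cycles_def bdry_def)
qed

text \<open>The values of \<open>bdry\<close> lie in \<open>aleph T\<close>, which consists of
  cycles.\<close>

lemma bdry_bdry:
  "\<eta> \<in> rcarrier (F_sums T) \<Longrightarrow> bdry T \<rho> j (bdry T \<rho> j \<eta>) = rzero (F_sums T)"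
  using bdry_aleph unfolding cycles_bdry[symmetric] cycles_def by blast

lemma bdry_image: "bdry T \<rho> j ` rcarrier (F_sums T) = Phi T \<rho> j ` rcarrier (K_sums T)"
  unfolding bdry_def image_comp[symmetric] conn_sums_image ..

text \<open>\<open>homology_iso\<close> is applied with \<open>Psi\<close> on
  \<open>aleph T\<close>: its kernel is the image of \<open>Phi\<close>, that is, the boundaries.
  Surjectivity comes from \<open>Psi_filtration\<close>, since every cycle has some upper
  bound.\<close>

lemma homology_bdry_iso:
  "\<exists>h \<in> rmod_iso (homology (F_sums T) (bdry T \<rho> j)) (FH T).
    (\<forall>\<eta>\<in>cycles (F_sums T) (bdry T \<rho> j).
       h (hclass (F_sums T) (bdry T \<rho> j) \<eta>) = Psi T \<rho> \<eta>) \<and>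
    (\<forall>p. h ` HF_filt T \<rho> j p = FH_filt T p)"
proof -
  interpret chain_module "F_sums T" "bdry T \<rho> j"
    by (simp add: chain_module_def chain_module_axioms_def right_module_F_sums bdry_hom bdry_bdry
        del: sums_simps)
  have "\<exists>h \<in> rmod_iso (homology (F_sums T) (bdry T \<rho> j)) (FH T).
    \<forall>\<eta>\<in>cycles (F_sums T) (bdry T \<rho> j). h (hclass (F_sums T) (bdry T \<rho> j) \<eta>) = Psi T \<rho> \<eta>"
  proof (rule homology_iso)
    show "Psi T \<rho> \<in> rmod_hom ((F_sums T)\<lparr>rcarrier := cycles (F_sums T) (bdry T \<rho> j)\<rparr>) (FH T)"
      using Psi_hom by (simp only: cycles_bdry flip: aleph_F_sums)
    show "Psi T \<rho> ` cycles (F_sums T) (bdry T \<rho> j) = rcarrier (FH T)"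
    proof (intro equalityI subsetI)
      fix X assume "X \<in> rcarrier (FH T)"
      then obtain z p where "z \<in> Z p" "X = cls T z" by (auto simp: FH_carrier Ztot_iff)
      then have "X \<in> FH_filt T p"
        unfolding FH_filt_def using iota_lim_cls cls_le_closed by (metis imageI)
      then show "X \<in> Psi T \<rho> ` cycles (F_sums T) (bdry T \<rho> j)"
        unfolding cycles_bdry Psi_filtration[symmetric] by blast
    qed (use rmod_hom_closed[OF Psi_hom] cycles_bdry in blast)
    fix \<eta> assume "\<eta> \<in> cycles (F_sums T) (bdry T \<rho> j)"
    then show "Psi T \<rho> \<eta> = rzero (FH T) \<longleftrightarrow> \<eta> \<in> bdry T \<rho> j ` rcarrier (F_sums T)"
      unfolding bdry_image cycles_bdry using Psi_kernel Psi_Phi by blast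
  qed (rule FH.right_module_axioms)
  then obtain h where h: "h \<in> rmod_iso (homology (F_sums T) (bdry T \<rho> j)) (FH T)"
    and hc: "\<And>\<eta>. \<eta> \<in> cycles (F_sums T) (bdry T \<rho> j) \<Longrightarrow>
      h (hclass (F_sums T) (bdry T \<rho> j) \<eta>) = Psi T \<rho> \<eta>" by blast
  have "h ` HF_filt T \<rho> j p = FH_filt T p" for p
  proof -
    \<comment> \<open>The filtration is defined through representatives, on which \<open>h\<close>
      is given by \<open>Psi\<close>.\<close>
    have "h ` HF_filt T \<rho> j p =
        Psi T \<rho> ` {\<eta> \<in> cycles (F_sums T) (bdry T \<rho> j). \<forall>b>p. \<eta> b = rzero (FHwin T b b)}"
      unfolding HF_filt_def image_image using hc by (intro image_cong) auto
    then show ?thesis by (simp only: cycles_bdry Psi_filtration)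
  qed
  then show ?thesis using h hc by blast
qed

end

theorem theorem85:
  fixes T :: "('c, 'r::ring_1) floer_data"
  assumes "semisimple_ring TYPE('r)"
    and "floer_triple T"
  shows "(\<exists>\<rho> j. linear_sections T \<rho> j) \<and>
    (\<forall>\<rho> j. linear_sections T \<rho> j \<longrightarrow>
      Psi T \<rho> \<in> rmod_hom (aleph T) (FH T) \<and>
      Phi T \<rho> j \<in> rmod_hom (K_sums T) (aleph T) \<and>
      bdry T \<rho> j \<in> rmod_hom (F_sums T) (F_sums T) \<and>
      (\<forall>\<eta>\<in>rcarrier (F_sums T). bdry T \<rho> j (bdry T \<rho> j \<eta>) = rzero (F_sums T)) \<and>
      cycles (F_sums T) (bdry T \<rho> j) \<subseteq> rcarrier (aleph T) \<and>
      (\<exists>h \<in> rmod_iso (homology (F_sums T) (bdry T \<rho> j)) (FH T).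
        (\<forall>\<eta>\<in>cycles (F_sums T) (bdry T \<rho> j).
           h (hclass (F_sums T) (bdry T \<rho> j) \<eta>) = Psi T \<rho> \<eta>) \<and>
        (\<forall>p. h ` HF_filt T \<rho> j p = FH_filt T p)))"
proof (intro conjI allI impI)
  interpret floer T using assms(2) by unfold_locales
  show "\<exists>\<rho> j. linear_sections T \<rho> j" using assms(1) by (rule linear_sections_exist)
  fix \<rho> j assume "linear_sections T \<rho> j"
  then interpret floer_sections T \<rho> j by unfold_locales
  show "Psi T \<rho> \<in> rmod_hom (aleph T) (FH T)" by (rule Psi_hom)
  show "Phi T \<rho> j \<in> rmod_hom (K_sums T) (aleph T)" by (rule Phi_hom)
  show "bdry T \<rho> j \<in> rmod_hom (F_sums T) (F_sums T)" by (rule bdry_hom)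
  show "\<forall>\<eta>\<in>rcarrier (F_sums T). bdry T \<rho> j (bdry T \<rho> j \<eta>) = rzero (F_sums T)"
    using bdry_bdry by blast
  show "cycles (F_sums T) (bdry T \<rho> j) \<subseteq> rcarrier (aleph T)" by (simp only: cycles_bdry order_refl)
  show "\<exists>h \<in> rmod_iso (homology (F_sums T) (bdry T \<rho> j)) (FH T).
      (\<forall>\<eta>\<in>cycles (F_sums T) (bdry T \<rho> j).
         h (hclass (F_sums T) (bdry T \<rho> j) \<eta>) = Psi T \<rho> \<eta>) \<and>
      (\<forall>p. h ` HF_filt T \<rho> j p = FH_filt T p)"
    by (rule homology_bdry_iso)
qed

end
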